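(* Let $C$ denote the subalgebra of the $q$-shuffle algebra $\mathbb V$ (the vector space $\mathbb V$ with product $\star$) generated by $\{C_n\}_{n=1}^\infty$. Let $\{\lambda_n\}_{n=1}^\infty$ be mutually commuting indeterminates and let $\mathbb F[\lambda_1,\lambda_2,\ldots]$ be the algebra of polynomials in $\{\lambda_n\}_{n=1}^\infty$ with coefficients in $\mathbb F$. Then there exists an algebra isomorphism $\mathbb F[\lambda_1,\lambda_2,\ldots]\to C$ that sends $\lambda_n\mapsto C_n$ for all $n\ge1$.
   Context: $\mathbb F$ is a field and $q\in\mathbb F$ is nonzero and not a root of unity. All algebras are associative, unital, over $\mathbb F$. $\mathbb N=\{0,1,2,\ldots\}$ and $[n]_q=\frac{q^n-q^{-n}}{q-q^{-1}}$ for $n\in\mathbb N$. $\mathbb V$ is the free algebra on noncommuting generators $x,y$ (its product, concatenation, is written by juxtaposition). It has a basis of words $v_1\cdots v_n$ with $v_i\in\{x,y\}$, $n\ge0$; the word of length $0$ is $1$ (trivial). Put $\langle x,x\rangle=\langle y,y\rangle=2$, $\langle x,y\rangle=\langle y,x\rangle=-2$. The $q$-shuffle product $\star$ is the bilinear associative product on the vector space $\mathbb V$ with $1\star v=v\star 1=v$ and, for nontrivial words $u=u_1\cdots u_r$, $v=v_1\cdots v_s$, $$u\star v=u_1\bigl((u_2\cdots u_r)\star v\bigr)+v_1\bigl(u\star(v_2\cdots v_s)\bigr)q^{\langle u_1,v_1\rangle+\langle u_2,v_1\rangle+\cdots+\langle u_r,v_1\rangle}.$$ The vector space $\mathbb V$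 with $\star$ is the $q$-shuffle algebra. Put $\overline x=1$, $\overline y=-1$. A word $a_1\cdots a_m$ is Catalan if $\overline a_1+\cdots+\overline a_m=0$ and $\overline a_1+\cdots+\overline a_i\ge0$ for $1\le i\le m$. For $n\ge 0$ the $n$th Catalan element is $$C_n=\sum a_1a_2\cdots a_{2n}\,[1]_q[1+\overline a_1]_q[1+\overline a_1+\overline a_2]_q\cdots[1+\overline a_1+\cdots+\overline a_{2n}]_q,$$ the sum being over all Catalan words $a_1\cdots a_{2n}$ of length $2n$. *)

theory Defs
  imports Complex_Main "HOL-Library.Poly_Mapping"
begin

datatype letter = X | Y

type_synonym word = "letter list"

text \<open>
  The underlying vector space of the free algebra on \<open>x, y\<close>: finitely supported
  functions from words to the field; the letters \<open>X, Y\<close> stand for \<open>x, y\<close>. The word \<open>w\<close> is \<open>Poly_Mapping.single w 1\<close>.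
\<close>
type_synonym 'a vv = "word \<Rightarrow>\<^sub>0 'a"

definition scale :: "'a::field \<Rightarrow> ('k \<Rightarrow>\<^sub>0 'a) \<Rightarrow> ('k \<Rightarrow>\<^sub>0 'a)" where
  "scale c f = Poly_Mapping.map ((*) c) f"

lemma lookup_scale: "Poly_Mapping.lookup (scale c f) k = c * Poly_Mapping.lookup f k"
  by (auto simp: scale_def Poly_Mapping.map.rep_eq when_def)

definition word_elt :: "word \<Rightarrow> 'a::field vv" where
  "word_elt w = Poly_Mapping.single w 1"

definition letter_times :: "letter \<Rightarrow> 'a::field vv \<Rightarrow> 'a vv" where
  "letter_times a f = (\<Sum>w\<in>Poly_Mapping.keys f. Poly_Mapping.single (a # w) (Poly_Mapping.lookup f w))"

lemma letter_times_word_elt: "letter_times a (word_elt w) = word_elt (a # w)"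
  by (simp add: letter_times_def word_elt_def)

fun pairing :: "letter \<Rightarrow> letter \<Rightarrow> int" where
  "pairing X X = 2"
| "pairing Y Y = 2"
| "pairing X Y = -2"
| "pairing Y X = -2"

fun qshuffle_words :: "'a::field \<Rightarrow> word \<Rightarrow> word \<Rightarrow> 'a vv" where
  "qshuffle_words q [] v = word_elt v"
| "qshuffle_words q (a # u) [] = word_elt (a # u)"
| "qshuffle_words q (a # u) (b # v) =
     letter_times a (qshuffle_words q u (b # v)) +
     scale (q powi (\<Sum>c\<leftarrow>a # u. pairing c b)) (letter_times b (qshuffle_words q (a # u) v))"

lemma qshuffle_words_Nil_right: "qshuffle_words q u [] = word_elt u"
  by (cases u) simp_all

definition qshuffle :: "'a::field \<Rightarrow> 'a vv \<Rightarrow> 'a vv \<Rightarrow> 'a vv" where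
  "qshuffle q f g = (\<Sum>u\<in>Poly_Mapping.keys f. \<Sum>v\<in>Poly_Mapping.keys g.
     scale (Poly_Mapping.lookup f u * Poly_Mapping.lookup g v) (qshuffle_words q u v))"

lemma qshuffle_word_elt: "qshuffle q (word_elt u) (word_elt v) = qshuffle_words q u v"
  by (rule poly_mapping_eqI) (simp add: qshuffle_def word_elt_def lookup_scale)

definition qshuffle_subalgebra :: "'a::field \<Rightarrow> 'a vv set \<Rightarrow> bool" where
  "qshuffle_subalgebra q S \<longleftrightarrow>
     word_elt [] \<in> S \<and>
     (\<forall>f\<in>S. \<forall>g\<in>S. f + g \<in> S) \<and>
     (\<forall>c. \<forall>f\<in>S. scale c f \<in> S) \<and>
     (\<forall>f\<in>S. \<forall>g\<in>S. qshuffle q f g \<in> S)"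

fun bar :: "letter \<Rightarrow> int" where
  "bar X = 1"
| "bar Y = -1"

definition height :: "word \<Rightarrow> int" where
  "height w = (\<Sum>a\<leftarrow>w. bar a)"

definition catalan_word :: "word \<Rightarrow> bool" where
  "catalan_word w \<longleftrightarrow> height w = 0 \<and> (\<forall>i\<in>{1..length w}. 0 \<le> height (take i w))"

text \<open>Stated for integer \<open>n\<close>; only \<open>n \<ge> 1\<close> occurs on Catalan words.\<close>
definition qnum :: "'a::field \<Rightarrow> int \<Rightarrow> 'a" where
  "qnum q n = (q powi n - q powi (- n)) / (q - inverse q)"

definition catalan_elt :: "'a::field \<Rightarrow> nat \<Rightarrow> 'a vv" where
  "catalan_elt q n = (\<Sum>w\<in>{w. length w = 2 * n \<and> catalan_word w}.
     scale (\<Prod>i=0..2 * n. qnum q (1 + height (take i w))) (word_elt w))"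

lemma finite_catalan_words: "finite {w. length w = 2 * n \<and> catalan_word w}"
proof (rule finite_subset)
  show "{w. length w = 2 * n \<and> catalan_word w} \<subseteq> {w. set w \<subseteq> {X, Y} \<and> length w = 2 * n}"
    by (auto intro: letter.exhaust)
  show "finite {w. set w \<subseteq> {X, Y} \<and> length w = 2 * n}"
    by (rule finite_lists_length_eq) simp
qed

definition catalan_subalgebra :: "'a::field \<Rightarrow> 'a vv set" where
  "catalan_subalgebra q = qshuffle_subalgebra q hull (catalan_elt q ` {1..})"

text \<open>
  The polynomial algebra in \<open>\<lambda>\<^sub>1, \<lambda>\<^sub>2, \<dots>\<close>: monomials are finitely supported exponent
  functions, and multiplication is the convolution product on \<open>\<Rightarrow>\<^sub>0\<close>. Exponent position
  \<open>i\<close> belongs to \<open>\<lambda>\<^bsub>i+1\<^esub>\<close>, so that all of \<open>nat\<close> is used; \<open>indet n\<close> is meaningful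
  only for \<open>n \<ge> 1\<close>.
\<close>
type_synonym 'a polys = "(nat \<Rightarrow>\<^sub>0 nat) \<Rightarrow>\<^sub>0 'a"

definition indet :: "nat \<Rightarrow> 'a::field polys" where
  "indet n = Poly_Mapping.single (Poly_Mapping.single (n - 1) 1) 1"

definition polys_iso_onto :: "'a::field \<Rightarrow> ('a polys \<Rightarrow> 'a vv) \<Rightarrow> 'a vv set \<Rightarrow> bool" where
  "polys_iso_onto q \<phi> S \<longleftrightarrow>
     (\<forall>f g. \<phi> (f + g) = \<phi> f + \<phi> g) \<and>
     (\<forall>c f. \<phi> (scale c f) = scale c (\<phi> f)) \<and>
     \<phi> 1 = word_elt [] \<and>
     (\<forall>f g. \<phi> (f * g) = qshuffle q (\<phi> f) (\<phi> g)) \<and>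
     bij_betw \<phi> UNIV S"

end

theory Submission
  imports Defs "HOL-Library.Multiset"
begin

text \<open>
  Stripping the first letter \<open>a\<close> from the coefficient function of an element is a twisted derivation
  \<open>D\<close> of the q-shuffle product: \<open>D (f \<star> g) = D f \<star> g + q^\<langle>wt f, a\<rangle> f \<star> D g\<close> for homogeneous \<open>f\<close>. An element is
  determined by its constant coefficient and its two strips. Hence a family of elements without
  constant coefficient is zero if all strips of its members are linear combinations of members, and
  identities are proved by exhibiting such a family.

  The link between the Catalan elements \<open>C n\<close> and polynomials are the alternating words
  \<open>G n = (xy)^n\<close>, about which three facts are shown.

  \<^item> They commute. The strips of the commutators bring in the words \<open>y(xy)^(n-1)\<close>, and together with
    three relations between these and the \<open>G n\<close> they form a closed family (\<open>alt_relations\<close>).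

  \<^item> Their monomials are linearly independent (\<open>independent_family_xy_mon\<close>). Removing the prefix
    \<open>x^r y^r\<close> annihilates a product of fewer than \<open>r\<close> alternating words, and turns
    \<open>G n1 \<star> \<dots> \<star> G nr\<close> into a nonzero multiple of \<open>G (n1 - 1) \<star> \<dots> \<star> G (nr - 1)\<close>; so a linear
    relation yields one of smaller degree.

  \<^item> With generating functions, \<open>C(-t) \<star> G(q t) \<star> G(t / q) = 1\<close>
    (\<open>catalan_path_qsh_alt_pair0\<close>, \<open>catalan_xy_conv\<close>). The weights \<open>[h + 1]_q\<close> of the Catalan paths give a
    family indexed by the height, and suitable combinations with the strips of \<open>G(q t) \<star> G(t / q)\<close> are
    closed under stripping.

  The last identity gives \<open>C n = - (-1)^n (q^n + q^(-n)) G n\<close> plus products of at least two alternating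
  words. So the \<open>C n\<close> commute, and as \<open>q^n + q^(-n) \<noteq> 0\<close> for \<open>q\<close> not a root of unity, each monomial in the
  Catalan elements is a nonzero multiple of the corresponding monomial in the alternating words plus
  monomials with more factors. Therefore the monomials in the Catalan elements are linearly
  independent too (\<open>independent_family_leading_term\<close>), which is the injectivity of the evaluation
  homomorphism from the polynomial algebra; its image is the subalgebra generated by the \<open>C n\<close>.
\<close>

section \<open>Coefficient functions and stripping of letters\<close>

text \<open>
  Elements of the q-shuffle algebra are handled through their coefficient functions on words,
  because there infinite sums such as \<open>\<Sum>n. c^n (xy)^n\<close> make sense and generating functions
  need no extra variable: the grading by word length does its work.
\<close>
definition strip :: "letter \<Rightarrow> (word \<Rightarrow> 'a) \<Rightarrow> word \<Rightarrow> 'a" where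
  "strip a f = (\<lambda>w. f (a # w))"

text \<open>
  Since \<open>\<langle>w, a\<rangle> = 2 * bar a * height w\<close>, the twist multiplies the coefficient of a word \<open>w\<close>
  by \<open>q^\<langle>w, a\<rangle>\<close>.
\<close>
definition twist :: "'a::field \<Rightarrow> letter \<Rightarrow> (word \<Rightarrow> 'a) \<Rightarrow> word \<Rightarrow> 'a" where
  "twist q a f = (\<lambda>w. q powi (2 * bar a * height w) * f w)"

text \<open>
  The q-shuffle product on coefficient functions. The defining recursion on pairs of words says
  that stripping the first letter is a twisted derivation; here this is taken as the definition, so
  that the recursion runs along the word at which the product is evaluated. Agreement with
  \<open>qshuffle\<close> is \<open>lookup_qshuffle\<close> below.
\<close>
fun qsh :: "'a::field \<Rightarrow> (word \<Rightarrow> 'a) \<Rightarrow> (word \<Rightarrow> 'a) \<Rightarrow> word \<Rightarrow> 'a" where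
  "qsh q f g [] = f [] * g []"
| "qsh q f g (a # w) = qsh q (strip a f) g w + qsh q (twist q a f) (strip a g) w"

definition delta :: "word \<Rightarrow> word \<Rightarrow> 'a::field" where
  "delta u = (\<lambda>w. if w = u then 1 else 0)"

lemma height_simps [simp]: "height [] = 0" "height (a # w) = bar a + height w"
  by (simp_all add: height_def)

lemma strip_qsh:
  "strip a (qsh q f g) = (\<lambda>w. qsh q (strip a f) g w + qsh q (twist q a f) (strip a g) w)"
  by (simp add: strip_def fun_eq_iff)

lemma qsh_add_left: "qsh q (\<lambda>w. f w + f' w) g = (\<lambda>w. qsh q f g w + qsh q f' g w)"
proof
  show "qsh q (\<lambda>w. f w + f' w) g w = qsh q f g w + qsh q f' g w" for w
    by (induction w arbitrary: f f' g) (simp_all add: strip_def twist_def algebra_simps)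
qed

lemma qsh_add_right: "qsh q f (\<lambda>w. g w + g' w) = (\<lambda>w. qsh q f g w + qsh q f g' w)"
proof
  show "qsh q f (\<lambda>w. g w + g' w) w = qsh q f g w + qsh q f g' w" for w
    by (induction w arbitrary: f g g') (simp_all add: strip_def twist_def algebra_simps)
qed

lemma qsh_scale_left: "qsh q (\<lambda>w. c * f w) g = (\<lambda>w. c * qsh q f g w)"
proof
  show "qsh q (\<lambda>w. c * f w) g w = c * qsh q f g w" for w
  proof (induction w arbitrary: f g)
    case (Cons a w)
    have "strip a (\<lambda>w. c * f w) = (\<lambda>w. c * strip a f w)"
      "twist q a (\<lambda>w. c * f w) = (\<lambda>w. c * twist q a f w)"
      by (simp_all add: strip_def twist_def algebra_simps)
    then show ?case by (simp add: Cons.IH distrib_left)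
  qed simp
qed

lemma qsh_scale_right: "qsh q f (\<lambda>w. c * g w) = (\<lambda>w. c * qsh q f g w)"
proof
  show "qsh q f (\<lambda>w. c * g w) w = c * qsh q f g w" for w
  proof (induction w arbitrary: f g)
    case (Cons a w)
    have "strip a (\<lambda>w. c * g w) = (\<lambda>w. c * strip a g w)"
      by (simp add: strip_def)
    then show ?case by (simp add: Cons.IH distrib_left)
  qed simp
qed

lemma qsh_zero [simp]: "qsh q (\<lambda>w. 0) g = (\<lambda>w. 0)" "qsh q f (\<lambda>w. 0) = (\<lambda>w. 0)"
  using qsh_scale_left[of q 0 f g] qsh_scale_right[of q f 0 g] by simp_all

lemma strip_zero [simp]: "strip a (\<lambda>w. 0) = (\<lambda>w. 0)"
  by (simp add: strip_def)

lemma strip_delta [simp]: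
  "strip a (delta []) = (\<lambda>w. 0)" "strip a (delta (b # u)) = (if a = b then delta u else (\<lambda>w. 0))"
  by (auto simp: strip_def delta_def fun_eq_iff)

definition homog :: "int \<Rightarrow> (word \<Rightarrow> 'a::zero) \<Rightarrow> bool" where
  "homog h f \<longleftrightarrow> (\<forall>w. f w \<noteq> 0 \<longrightarrow> height w = h)"

lemma twist_homog: "homog h f \<Longrightarrow> twist q a f = (\<lambda>w. q powi (2 * bar a * h) * f w)"
  by (auto simp: homog_def twist_def fun_eq_iff)

text \<open>
  The form in which the derivation rule is used: two coefficient functions agree as soon as they
  agree at the empty word and have equal strips, so an identity between products follows by
  induction on words once this rule reproduces identities of the same kind.
\<close>
lemma strip_qsh_homog:
  assumes "homog h f"
  shows "strip a (qsh q f g) =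
    (\<lambda>w. qsh q (strip a f) g w + q powi (2 * bar a * h) * qsh q f (strip a g) w)"
  by (simp add: strip_qsh twist_homog[OF assms] qsh_scale_left)

lemma homog_delta: "homog (height u) (delta u)"
  by (simp add: homog_def delta_def)

lemma delta_Nil: "delta [] [] = 1" by (simp add: delta_def)

lemma strip_at: "strip a f w = f (a # w)" by (simp add: strip_def)

lemma qsh_Cons: "qsh q f g (a # w) = strip a (qsh q f g) w" by (simp add: strip_def)

lemma qsh_one_left: "qsh q (delta []) g = g"
proof
  show "qsh q (delta []) g w = g w" for w
  proof (induction w arbitrary: g)
    case (Cons a w)
    then show ?case
      using twist_homog[OF homog_delta[of "[]"], of q a] by (simp add: strip_at)
  qed (simp add: delta_def)
qed

lemma qsh_one_right: "qsh q f (delta []) = f"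
proof
  show "qsh q f (delta []) w = f w" for w
    by (induction w arbitrary: f) (simp_all add: delta_Nil strip_at)
qed

section \<open>Commutation of alternating words\<close>

text \<open>
  The alternating words \<open>G n = (xy)^n\<close> and \<open>W n = y(xy)^(n-1)\<close>. The value \<open>W 0 = 0\<close>
  makes the strips uniform in \<open>n\<close>.
\<close>
definition alt_G :: "nat \<Rightarrow> word \<Rightarrow> 'a::field" where
  "alt_G n = delta (concat (replicate n [X, Y]))"

definition alt_W :: "nat \<Rightarrow> word \<Rightarrow> 'a::field" where
  "alt_W n = strip X (alt_G n)"

lemma alt_simps:
  "alt_G 0 = delta []"
  "strip X (alt_G n) = alt_W n" "strip Y (alt_G n) = (\<lambda>w. 0)"
  "strip X (alt_W n) = (\<lambda>w. 0)" "strip Y (alt_W (Suc n)) = alt_G n"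
  "alt_W 0 = (\<lambda>w. 0)"
  "alt_G n [] = (if n = 0 then 1 else 0)" "alt_W n [] = 0"
  by (cases n; simp add: alt_G_def alt_W_def; simp add: delta_def)+

lemma homog_alt_G: "homog 0 (alt_G n)"
proof -
  have "height (concat (replicate n [X, Y])) = 0" by (induction n) simp_all
  then show ?thesis using homog_delta[of "concat (replicate n [X, Y])"] by (simp add: alt_G_def)
qed

lemma homog_strip: "homog h f \<Longrightarrow> homog (h - bar a) (strip a f)"
  by (auto simp: homog_def strip_def)

lemma homog_alt_W: "homog (-1) (alt_W n)"
  using homog_strip[OF homog_alt_G[of n], of X] by (simp add: alt_W_def)

lemma strip_qsh_alt:
  "strip X (qsh q (alt_G n) f) = (\<lambda>w. qsh q (alt_W n) f w + qsh q (alt_G n) (strip X f) w)"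
  "strip Y (qsh q (alt_G n) f) = (\<lambda>w. qsh q (alt_G n) (strip Y f) w)"
  "strip X (qsh q (alt_W n) f) = (\<lambda>w. q powi (-2) * qsh q (alt_W n) (strip X f) w)"
  "strip Y (qsh q (alt_W (Suc n)) f) =
     (\<lambda>w. qsh q (alt_G n) f w + q powi 2 * qsh q (alt_W (Suc n)) (strip Y f) w)"
  by (simp_all only: strip_qsh_homog[OF homog_alt_G] strip_qsh_homog[OF homog_alt_W] alt_simps qsh_zero)
    simp_all

context
  fixes q :: "'a::field"
  assumes q0: "q \<noteq> 0"
begin

text \<open>
  Weights add up in the q-shuffle product.
\<close>
lemma twist_qsh: "twist q a (qsh q f g) = qsh q (twist q a f) (twist q a g)"
proof
  show "twist q a (qsh q f g) w = qsh q (twist q a f) (twist q a g) w" for w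
  proof (induction w arbitrary: f g)
    case (Cons b w)
    have strip: "strip b (twist q a f) = (\<lambda>w. q powi (2 * bar a * bar b) * twist q a (strip b f) w)"
      for f :: "word \<Rightarrow> 'a"
      by (simp add: strip_def twist_def fun_eq_iff distrib_left power_int_add q0)
    have comm: "twist q b (twist q a f) = twist q a (twist q b f)"
      by (simp add: twist_def fun_eq_iff)
    have "twist q a (qsh q f g) (b # w) = q powi (2 * bar a * bar b) *
        (twist q a (qsh q (strip b f) g) w + twist q a (qsh q (twist q b f) (strip b g)) w)"
      by (simp add: twist_def distrib_left power_int_add q0 mult.assoc)
    also have "\<dots> = qsh q (twist q a f) (twist q a g) (b # w)"
      by (simp add: Cons.IH strip comm qsh_scale_left qsh_scale_right distrib_left)
    finally show ?case .
  qed (simp add: twist_def)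
qed

lemma qsh_assoc: "qsh q (qsh q f g) h = qsh q f (qsh q g h)"
proof
  show "qsh q (qsh q f g) h w = qsh q f (qsh q g h) w" for w
    by (induction w arbitrary: f g h)
      (simp_all add: strip_qsh twist_qsh qsh_add_left qsh_add_right)
qed

text \<open>
  The first relation is the goal; the other three are what its strips need. Stripping \<open>x\<close> or \<open>y\<close>
  from one of the four turns it into a combination of them: \<open>x\<close> leads from \<open>GG\<close> to the third relation
  and from the third and fourth to \<open>WW\<close>; \<open>y\<close> leads from the third and fourth back to \<open>GG\<close> and from
  \<open>WW\<close> to the fourth.
\<close>
lemma alt_relations:
  "qsh q (alt_G m) (alt_G n) w = qsh q (alt_G n) (alt_G m) w \<and>
   qsh q (alt_W m) (alt_W n) w = qsh q (alt_W n) (alt_W m) w \<and>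
   qsh q (alt_G m) (alt_W n) w - qsh q (alt_W n) (alt_G m) w =
     qsh q (alt_G n) (alt_W m) w - qsh q (alt_W m) (alt_G n) w \<and>
   qsh q (alt_G m) (alt_W (Suc n)) w - q powi 2 * qsh q (alt_W (Suc n)) (alt_G m) w =
     qsh q (alt_G n) (alt_W (Suc m)) w - q powi 2 * qsh q (alt_W (Suc m)) (alt_G n) w"
proof (induction w arbitrary: m n)
  case Nil
  show ?case by (simp add: alt_simps)
next
  case (Cons a w)
  have GG: "qsh q (alt_G m) (alt_G n) w = qsh q (alt_G n) (alt_G m) w"
    and WW: "qsh q (alt_W m) (alt_W n) w = qsh q (alt_W n) (alt_W m) w"
    and GW: "qsh q (alt_G m) (alt_W n) w - qsh q (alt_W n) (alt_G m) w =
     qsh q (alt_G n) (alt_W m) w - qsh q (alt_W m) (alt_G n) w"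
    and GWS: "qsh q (alt_G m) (alt_W (Suc n)) w - q powi 2 * qsh q (alt_W (Suc n)) (alt_G m) w =
     qsh q (alt_G n) (alt_W (Suc m)) w - q powi 2 * qsh q (alt_W (Suc m)) (alt_G n) w" for m n
    using Cons.IH by blast+
  show ?case
  proof (cases a)
    case X
    show ?thesis unfolding qsh_Cons X strip_qsh_alt alt_simps
      using GW[of m n] WW q0
      by (auto simp: algebra_simps power_int_minus mult.assoc[symmetric, of "q\<^sup>2"])
  next
    case Y
    show ?thesis
    proof (cases m; cases n)
      fix m' n' assume "m = Suc m'" "n = Suc n'"
      then show ?thesis unfolding qsh_Cons Y
        using GG GWS[of m' n'] by (simp add: strip_qsh_alt alt_simps) (simp add: algebra_simps)
    qed (unfold qsh_Cons Y, auto simp: strip_qsh_alt alt_simps GG qsh_one_left qsh_one_right)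
  qed
qed

end

section \<open>Removing prefixes of products of alternating words\<close>

lemma strip_linear:
  fixes f :: "word \<Rightarrow> 'a::field"
  shows "strip a (\<lambda>w. f w + g w) = (\<lambda>w. strip a f w + strip a g w)"
  "strip a (\<lambda>w. c * f w) = (\<lambda>w. c * strip a f w)"
  by (simp_all add: strip_def)

lemma strip_pow_zero [simp]: "(strip a ^^ k) (\<lambda>w. 0) = (\<lambda>w. 0)"
  by (induction k) simp_all

lemma strip_pow_linear:
  fixes f :: "word \<Rightarrow> 'a::field"
  shows "(strip a ^^ k) (\<lambda>w. f w + g w) = (\<lambda>w. (strip a ^^ k) f w + (strip a ^^ k) g w)"
  "(strip a ^^ k) (\<lambda>w. c * f w) = (\<lambda>w. c * (strip a ^^ k) f w)"
  by (induction k) (simp_all add: strip_linear)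

text \<open>
  Stripping \<open>x\<close> twice kills \<open>G n\<close>, so in a power of the derivation at most one factor \<open>x\<close> is taken
  from \<open>G n\<close>; moving the other ones past the resulting \<open>W n\<close> of weight \<open>y\<close> costs \<open>q^(-2)\<close> each.
\<close>
lemma strip_X_pow_qsh_alt_G:
  "(strip X ^^ Suc k) (qsh q (alt_G n) f) =
     (\<lambda>w. qsh q (alt_G n) ((strip X ^^ Suc k) f) w +
       (\<Sum>i<Suc k. (q powi (-2)) ^ i) * qsh q (alt_W n) ((strip X ^^ k) f) w)"
proof (induction k)
  case 0
  show ?case by (simp add: strip_qsh_alt algebra_simps)
next
  case (Suc k)
  define c where "c = (\<Sum>i<Suc k. (q powi (-2)) ^ i)"
  have "(\<Sum>i<Suc (Suc k). (q powi (-2)) ^ i) = 1 + q powi (-2) * c"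
    unfolding c_def by (subst sum.lessThan_Suc_shift) (simp add: sum_distrib_left del: sum.lessThan_Suc)
  then show ?case
    by (subst funpow.simps, subst comp_apply, subst Suc.IH)
      (simp add: strip_qsh_alt strip_linear algebra_simps flip: c_def del: sum.lessThan_Suc)
qed

lemma strip_Y_pow_qsh_alt_W:
  "(strip Y ^^ Suc k) (qsh q (alt_W (Suc n)) f) =
     (\<lambda>w. (\<Sum>i<Suc k. (q ^ 2) ^ i) * qsh q (alt_G n) ((strip Y ^^ k) f) w +
       (q ^ 2) ^ Suc k * qsh q (alt_W (Suc n)) ((strip Y ^^ Suc k) f) w)"
proof (induction k)
  case 0
  show ?case by (simp add: strip_qsh_alt algebra_simps)
next
  case (Suc k)
  define c where "c = (\<Sum>i<Suc k. (q ^ 2) ^ i)"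
  have "(\<Sum>i<Suc (Suc k). (q ^ 2) ^ i) = c + (q ^ 2) ^ Suc k"
    unfolding c_def by simp
  then show ?case
    by (subst funpow.simps, subst comp_apply, subst Suc.IH)
      (simp add: strip_qsh_alt strip_linear algebra_simps flip: c_def del: sum.lessThan_Suc)
qed

text \<open>
  \<open>f\<close> behaves like a product of \<open>r\<close> alternating words: removing the prefix \<open>x^r y^r\<close> gives
  \<open>g\<close> up to the scalar \<open>c\<close>, and neither more than \<open>r\<close> letters \<open>x\<close> nor, after \<open>x^r\<close>, more than \<open>r\<close>
  letters \<open>y\<close> can be removed. The two vanishing conditions keep the induction on \<open>r\<close> going.
\<close>
definition peels_to :: "nat \<Rightarrow> (word \<Rightarrow> 'a::field) \<Rightarrow> 'a \<Rightarrow> (word \<Rightarrow> 'a) \<Rightarrow> bool" where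
  "peels_to r f c g \<longleftrightarrow> (strip X ^^ Suc r) f = (\<lambda>w. 0) \<and>
     (strip Y ^^ Suc r) ((strip X ^^ r) f) = (\<lambda>w. 0) \<and>
     (strip Y ^^ r) ((strip X ^^ r) f) = (\<lambda>w. c * g w)"

lemma peels_to_one: "peels_to 0 (delta []) 1 (delta [])"
  by (simp add: peels_to_def)

text \<open>
  One more factor: of the \<open>r + 1\<close> letters \<open>x\<close> removed, one must come from the new word,
  and likewise for \<open>y\<close>. Only the q-count of the possible positions of that letter appears.
\<close>
lemma peels_to_alt_G:
  assumes "peels_to r f c g"
  shows "peels_to (Suc r) (qsh q (alt_G (Suc n)) f)
    ((\<Sum>i<Suc r. (q powi (-2)) ^ i) * (\<Sum>i<Suc r. (q ^ 2) ^ i) * c) (qsh q (alt_G n) g)"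
proof -
  have a: "(strip X ^^ Suc r) f = (\<lambda>w. 0)"
    and b: "(strip Y ^^ Suc r) ((strip X ^^ r) f) = (\<lambda>w. 0)"
    and c: "(strip Y ^^ r) ((strip X ^^ r) f) = (\<lambda>w. c * g w)"
    using assms unfolding peels_to_def by blast+
  have a': "(strip X ^^ Suc (Suc r)) f = (\<lambda>w. 0)"
    using a by (subst funpow.simps) simp
  have b': "(strip Y ^^ Suc (Suc r)) ((strip X ^^ r) f) = (\<lambda>w. 0)"
    using b by (subst funpow.simps) simp
  show ?thesis
    unfolding peels_to_def strip_X_pow_qsh_alt_G a a' qsh_zero
    by (simp only: add_0 add_0_right mult_zero_right strip_pow_linear strip_Y_pow_qsh_alt_W b b' c qsh_zero qsh_scale_right)
      (simp add: mult.assoc)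
qed

section \<open>Inverting the generating function of the Catalan elements\<close>

text \<open>
  The generating function of the Catalan elements, for paths that start at height \<open>h\<close> and end at
  height \<open>0\<close>, with the sign \<open>(-1)^n\<close> for \<open>n\<close> letters \<open>y\<close>. The condition that a path stays nonnegative
  is built into the weights: a path can leave the nonnegative heights only through height \<open>-1\<close>, where
  the factor is \<open>[0]_q = 0\<close>.
\<close>
fun catalan_path :: "'a::field \<Rightarrow> int \<Rightarrow> word \<Rightarrow> 'a" where
  "catalan_path q h [] = (if h = 0 then 1 else 0)"
| "catalan_path q h (X # w) = qnum q (h + 1) * catalan_path q (h + 1) w"
| "catalan_path q h (Y # w) = - qnum q (h + 1) * catalan_path q (h - 1) w"

text \<open>
  The generating functions of \<open>G n\<close> and \<open>W n\<close> with \<open>c\<close> in place of the formal variable.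
\<close>
fun alt_G_series alt_W_series :: "'a::field \<Rightarrow> word \<Rightarrow> 'a" where
  "alt_G_series c [] = 1"
| "alt_G_series c (X # w) = alt_W_series c w"
| "alt_G_series c (Y # w) = 0"
| "alt_W_series c [] = 0"
| "alt_W_series c (X # w) = 0"
| "alt_W_series c (Y # w) = c * alt_G_series c w"

lemma qnum_0: "qnum q 0 = 0"
  by (simp add: qnum_def)

lemma catalan_path_neg: "h < 0 \<Longrightarrow> catalan_path q h w = 0"
proof (induction w arbitrary: h)
  case (Cons a w)
  show ?case
  proof (cases a)
    case X
    with Cons show ?thesis by (cases "h = -1") (simp_all add: qnum_0)
  next
    case Y
    with Cons show ?thesis by simp
  qed
qed simp

lemma strip_series:
  "strip X (catalan_path q h) = (\<lambda>w. qnum q (h + 1) * catalan_path q (h + 1) w)"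
  "strip Y (catalan_path q h) = (\<lambda>w. - qnum q (h + 1) * catalan_path q (h - 1) w)"
  "strip X (alt_G_series c) = alt_W_series c" "strip Y (alt_G_series c) = (\<lambda>w. 0)"
  "strip X (alt_W_series c) = (\<lambda>w. 0)" "strip Y (alt_W_series c) = (\<lambda>w. c * alt_G_series c w)"
  by (simp_all add: strip_def)

lemma homog_catalan_path: "homog (- h) (catalan_path q h)"
proof -
  have "catalan_path q h w \<noteq> 0 \<longrightarrow> height w = - h" for w
    by (induction q h w rule: catalan_path.induct) auto
  then show ?thesis by (simp add: homog_def)
qed

lemma homog_alt_series: "homog 0 (alt_G_series c)" "homog (-1) (alt_W_series c)"
proof -
  have "alt_G_series c w \<noteq> 0 \<longrightarrow> height w = 0" "alt_W_series c w \<noteq> 0 \<longrightarrow> height w = -1" for w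
    by (induction c w and c w rule: alt_G_series_alt_W_series.induct) auto
  then show "homog 0 (alt_G_series c)" "homog (-1) (alt_W_series c)" by (simp_all add: homog_def)
qed

text \<open>
  The product \<open>G(q t) \<star> G(t / q)\<close> and the two functions that its strips produce. The choice of the
  ratio \<open>q^2\<close> of the parameters makes the span of these three functions closed under stripping;
  for other parameters the two summands of \<open>alt_pair1\<close> would separate.
\<close>
definition alt_pair0 :: "'a::field \<Rightarrow> word \<Rightarrow> 'a" where
  "alt_pair0 q = qsh q (alt_G_series q) (alt_G_series (inverse q))"

definition alt_pair1 :: "'a::field \<Rightarrow> word \<Rightarrow> 'a" where
  "alt_pair1 q = (\<lambda>w. qsh q (alt_W_series q) (alt_G_series (inverse q)) w + qsh q (alt_G_series q) (alt_W_series (inverse q)) w)"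

definition alt_pair2 :: "'a::field \<Rightarrow> word \<Rightarrow> 'a" where
  "alt_pair2 q = qsh q (alt_W_series q) (alt_W_series (inverse q))"

text \<open>
  \<open>tower q 1\<close> is what stripping \<open>x\<close> from \<open>catalan_path q 0 \<star> alt_pair0 q\<close> yields, and
  the scalars for other \<open>k\<close> are forced by the wish that stripping \<open>x\<close> from level \<open>k\<close> gives a multiple
  of level \<open>k + 1\<close>. The point is that stripping \<open>y\<close> from level \<open>1\<close> then gives \<open>0\<close>, so that
  the levels \<open>k \<ge> 1\<close> form a closed family; the same holds for \<open>k \<le> -1\<close>.
\<close>
definition tower :: "'a::field \<Rightarrow> int \<Rightarrow> word \<Rightarrow> 'a" where
  "tower q k = (\<lambda>w. qsh q (catalan_path q k) (alt_pair0 q) w +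
     q powi (1 - k) * qsh q (catalan_path q (k - 1)) (alt_pair1 q) w +
     q powi (3 - 2 * k) * qsh q (catalan_path q (k - 2)) (alt_pair2 q) w)"

context
  fixes q :: "'a::field"
  assumes q0: "q \<noteq> 0" and q2: "q ^ 2 \<noteq> 1"
begin

lemma strip_alt_pair:
  "strip X (alt_pair0 q) = alt_pair1 q" "strip Y (alt_pair0 q) = (\<lambda>w. 0)"
  "strip X (alt_pair1 q) = (\<lambda>w. (1 + 1 / q ^ 2) * alt_pair2 q w)"
  "strip Y (alt_pair1 q) = (\<lambda>w. (q + 1 / q) * alt_pair0 q w)"
  "strip X (alt_pair2 q) = (\<lambda>w. 0)" "strip Y (alt_pair2 q) = (\<lambda>w. q * alt_pair1 q w)"
  by (simp_all add: alt_pair0_def alt_pair1_def alt_pair2_def strip_linear strip_qsh_homog[OF homog_alt_series(1)]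
    strip_qsh_homog[OF homog_alt_series(2)] strip_series qsh_scale_left qsh_scale_right fun_eq_iff
    algebra_simps power2_eq_square power_int_minus divide_inverse q0)

lemma alt_pair_Nil: "alt_pair0 q [] = 1" "alt_pair1 q [] = 0" "alt_pair2 q [] = 0"
  by (simp_all add: alt_pair0_def alt_pair1_def alt_pair2_def)

lemma q_diff_nonzero: "q - inverse q \<noteq> 0"
  using q0 q2 by (auto simp: field_simps power2_eq_square)

text \<open>
  Only the heights change, as \<open>catalan_path q h\<close> has weight \<open>-h\<close>.
\<close>
lemma strip_qsh_catalan_path:
  "strip X (qsh q (catalan_path q h) f) = (\<lambda>w. qnum q (h + 1) * qsh q (catalan_path q (h + 1)) f w +
     q powi (- 2 * h) * qsh q (catalan_path q h) (strip X f) w)"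
  "strip Y (qsh q (catalan_path q h) f) = (\<lambda>w. - qnum q (h + 1) * qsh q (catalan_path q (h - 1)) f w +
     q powi (2 * h) * qsh q (catalan_path q h) (strip Y f) w)"
  by (simp_all only: strip_qsh_homog[OF homog_catalan_path] strip_series qsh_scale_left) simp_all

lemma strip_tower:
  "strip X (tower q k) = (\<lambda>w. qnum q (k + 1) * tower q (k + 1) w)"
  "strip Y (tower q k) = (\<lambda>w. - (q powi (-2)) * qnum q (k - 1) * tower q (k - 1) w)"
proof -
  \<comment> \<open>With \<open>t = q^k\<close> every scalar is a rational function of \<open>q\<close> and \<open>t\<close>, and comparing the
    coefficients of the three products reduces both claims to identities between such functions.\<close>
  define t where "t = q powi k"
  have t0: "t \<noteq> 0" by (simp add: t_def q0)
  have pw: "q powi (1 - k) = q / t" "q powi (3 - 2 * k) = q ^ 3 / t ^ 2"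
    "q powi (- k) = 1 / t" "q powi (1 - 2 * k) = q / t ^ 2"  "q powi (2 - k) = q ^ 2 / t"
    "q powi (5 - 2 * k) = q ^ 5 / t ^ 2"
    "q powi (- 2 * k) = 1 / t ^ 2" "q powi (2 - 2 * k) = q ^ 2 / t ^ 2" "q powi (4 - 2 * k) = q ^ 4 / t ^ 2"
    "q powi (2 * k) = t ^ 2" "q powi (2 * k - 2) = t ^ 2 / q ^ 2" "q powi (2 * k - 4) = t ^ 2 / q ^ 4"
    using q0 by (simp_all add: t_def power_int_diff power_int_minus power_int_mult mult.commute[of 2 k] field_simps)
  define d where "d = q ^ 2 - 1"
  have d0: "d \<noteq> 0" using q2 by (simp add: d_def)
  have dq: "q - inverse q = d / q" using q0 by (simp add: d_def field_simps power2_eq_square)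
  have qn: "qnum q (k + 1) = (t * q - 1 / (t * q)) * q / d" "qnum q k = (t - 1 / t) * q / d"
    "qnum q (k - 1) = (t / q - q / t) * q / d"
  proof -
    have "q powi (k + 1) = t * q" "q powi (- (k + 1)) = 1 / (t * q)" "q powi (- k) = 1 / t"
      "q powi (k - 1) = t / q" "q powi (- (k - 1)) = q / t"
      using q0 by (simp_all add: t_def power_int_add power_int_diff power_int_minus field_simps)
    then show "qnum q (k + 1) = (t * q - 1 / (t * q)) * q / d" "qnum q k = (t - 1 / t) * q / d"
      "qnum q (k - 1) = (t / q - q / t) * q / d"
      unfolding qnum_def dq by (simp_all add: t_def)
  qed
  let ?c = "catalan_path q"
  show "strip X (tower q k) = (\<lambda>w. qnum q (k + 1) * tower q (k + 1) w)"
  proof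
    fix w
    define a b c where "a = qsh q (?c (k + 1)) (alt_pair0 q) w" and "b = qsh q (?c k) (alt_pair1 q) w"
      and "c = qsh q (?c (k - 1)) (alt_pair2 q) w"
    have 1: "strip X (qsh q (?c k) (alt_pair0 q)) w = qnum q (k + 1) * a + 1 / t ^ 2 * b"
      by (simp add: strip_qsh_catalan_path strip_alt_pair pw[simplified] a_def b_def)
    have 2: "strip X (qsh q (?c (k - 1)) (alt_pair1 q)) w = qnum q k * b + q ^ 2 / t ^ 2 * (1 + 1 / q ^ 2) * c"
    proof -
      have e: "k - 1 + 1 = k" "- 2 * (k - 1) = 2 - 2 * k" by simp_all
      show ?thesis unfolding strip_qsh_catalan_path strip_alt_pair qsh_scale_right e pw b_def c_def by simp
    qed
    have 3: "strip X (qsh q (?c (k - 2)) (alt_pair2 q)) w = qnum q (k - 1) * c"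
      by (simp add: strip_qsh_catalan_path strip_alt_pair c_def)
    have "tower q (k + 1) w = a + 1 / t * b + q / t ^ 2 * c"
      using pw by (simp add: tower_def a_def b_def c_def)
    moreover have "strip X (tower q k) w = qnum q (k + 1) * a + 1 / t ^ 2 * b +
        q / t * (qnum q k * b + q ^ 2 / t ^ 2 * (1 + 1 / q ^ 2) * c) +
        q ^ 3 / t ^ 2 * (qnum q (k - 1) * c)"
      unfolding tower_def strip_linear 1 2 3 pw by (rule refl)
    moreover have "1 / t ^ 2 + q / t * qnum q k = qnum q (k + 1) * (1 / t)"
      unfolding qn using q0 t0 d0
      by (simp add: field_simps) (simp add: d_def algebra_simps eval_nat_numeral)
    moreover have "q / t * (q ^ 2 / t ^ 2 * (1 + 1 / q ^ 2)) + q ^ 3 / t ^ 2 * qnum q (k - 1) =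
        qnum q (k + 1) * (q / t ^ 2)"
      unfolding qn using q0 t0 d0
      by (simp add: field_simps) (simp add: d_def algebra_simps eval_nat_numeral)
    ultimately show "strip X (tower q k) w = qnum q (k + 1) * tower q (k + 1) w"
      by algebra
  qed
  show "strip Y (tower q k) = (\<lambda>w. - (q powi (-2)) * qnum q (k - 1) * tower q (k - 1) w)"
  proof
    fix w
    define a b c where "a = qsh q (?c (k - 1)) (alt_pair0 q) w" and "b = qsh q (?c (k - 2)) (alt_pair1 q) w"
      and "c = qsh q (?c (k - 3)) (alt_pair2 q) w"
    have 1: "strip Y (qsh q (?c k) (alt_pair0 q)) w = - qnum q (k + 1) * a"
      by (simp add: strip_qsh_catalan_path strip_alt_pair a_def)
    have 2: "strip Y (qsh q (?c (k - 1)) (alt_pair1 q)) w = - qnum q k * b + t ^ 2 / q ^ 2 * (q + 1 / q) * a"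
    proof -
      have e: "k - 1 + 1 = k" "k - 1 - 1 = k - 2" "2 * (k - 1) = 2 * k - 2" by simp_all
      show ?thesis unfolding strip_qsh_catalan_path strip_alt_pair qsh_scale_right e pw a_def b_def by simp
    qed
    have 3: "strip Y (qsh q (?c (k - 2)) (alt_pair2 q)) w = - qnum q (k - 1) * c + t ^ 2 / q ^ 4 * q * b"
    proof -
      have e: "k - 2 + 1 = k - 1" "k - 2 - 1 = k - 3" "2 * (k - 2) = 2 * k - 4" by simp_all
      show ?thesis unfolding strip_qsh_catalan_path strip_alt_pair qsh_scale_right e pw b_def c_def by simp
    qed
    have "tower q (k - 1) w = a + q ^ 2 / t * b + q ^ 5 / t ^ 2 * c"
      using pw by (simp add: tower_def a_def b_def c_def)
    moreover have "strip Y (tower q k) w = - qnum q (k + 1) * a +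
        q / t * (- qnum q k * b + t ^ 2 / q ^ 2 * (q + 1 / q) * a) +
        q ^ 3 / t ^ 2 * (- qnum q (k - 1) * c + t ^ 2 / q ^ 4 * q * b)"
      unfolding tower_def strip_linear 1 2 3 pw by (rule refl)
    moreover have "- qnum q (k + 1) + q / t * (t ^ 2 / q ^ 2 * (q + 1 / q)) = - (1 / q ^ 2) * qnum q (k - 1)"
      unfolding qn using q0 t0 d0
      by (simp add: field_simps) (simp add: d_def algebra_simps eval_nat_numeral)
    moreover have "q / t * (- qnum q k) + q ^ 3 / t ^ 2 * (t ^ 2 / q ^ 4 * q) =
        - (1 / q ^ 2) * qnum q (k - 1) * (q ^ 2 / t)"
      unfolding qn using q0 t0 d0
      by (simp add: field_simps) (simp add: d_def algebra_simps eval_nat_numeral)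
    moreover have "- (q ^ 3 / t ^ 2) * qnum q (k - 1) = - (1 / q ^ 2) * qnum q (k - 1) * (q ^ 5 / t ^ 2)"
      using q0 by (simp add: field_simps eval_nat_numeral)
    moreover have "q powi (-2) = 1 / q ^ 2"
      by (simp add: power_int_minus field_simps)
    ultimately show "strip Y (tower q k) w = - (q powi (-2)) * qnum q (k - 1) * tower q (k - 1) w"
      by algebra
  qed
qed

text \<open>
  The factors \<open>[k + 1]_q\<close> and \<open>[k - 1]_q\<close> vanish exactly where a strip would lead to level \<open>0\<close>, the only
  level that is nonzero at the empty word.
\<close>
lemma tower_eq_0: "k \<noteq> 0 \<Longrightarrow> tower q k w = 0"
proof (induction w arbitrary: k)
  case Nil
  then show ?case by (simp add: tower_def alt_pair_Nil)
next
  case (Cons a w)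
  have "strip a (tower q k) w = 0"
  proof (cases a)
    case X
    then show ?thesis using Cons.IH[of "k + 1"] by (cases "k = -1") (simp_all add: strip_tower qnum_0)
  next
    case Y
    then show ?thesis using Cons.IH[of "k - 1"] by (cases "k = 1") (simp_all add: strip_tower qnum_0)
  qed
  then show ?case by (simp add: strip_at)
qed

text \<open>
  The identity \<open>C(-t) \<star> G(q t) \<star> G(t / q) = 1\<close>.
\<close>
lemma catalan_path_qsh_alt_pair0: "qsh q (catalan_path q 0) (alt_pair0 q) = delta []"
proof
  fix w
  show "qsh q (catalan_path q 0) (alt_pair0 q) w = delta [] w"
  proof (cases w)
    case (Cons a u)
    have "qnum q 1 = 1" using q_diff_nonzero by (simp add: qnum_def field_simps)
    have "tower q 1 u = 0" by (rule tower_eq_0) simp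
    have "catalan_path q (-1) = (\<lambda>w. 0)" by (intro ext catalan_path_neg) simp
    then have "strip a (qsh q (catalan_path q 0) (alt_pair0 q)) u = 0"
      using \<open>tower q 1 u = 0\<close> \<open>qnum q 1 = 1\<close>
      by (cases a) (simp_all add: strip_qsh_homog[OF homog_catalan_path] strip_alt_pair strip_series tower_def
         qsh_scale_left)
    with Cons show ?thesis by (simp add: strip_at delta_def)
  qed (simp add: delta_Nil alt_pair_Nil)
qed

end

section \<open>Extraction of homogeneous parts\<close>

text \<open>
  Counting the letters \<open>y\<close> is a grading for which stripping \<open>x\<close> has degree \<open>0\<close> and stripping \<open>y\<close>
  degree \<open>1\<close>; it separates the terms of the generating functions.
\<close>
definition y_part :: "nat \<Rightarrow> (word \<Rightarrow> 'a::zero) \<Rightarrow> word \<Rightarrow> 'a" where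
  "y_part n f = (\<lambda>w. if count_list w Y = n then f w else 0)"

lemma y_part_zero [simp]: "y_part n (\<lambda>w. 0) = (\<lambda>w. 0)"
  by (simp add: y_part_def)

lemma y_part_scale: "y_part n (\<lambda>w. c * f w) = (\<lambda>w. c * y_part n f w)"
  for c :: "'a::field"
  by (simp add: y_part_def fun_eq_iff)

lemma strip_y_part:
  "strip X (y_part n f) = y_part n (strip X f)"
  "strip Y (y_part 0 f) = (\<lambda>w. 0)"
  "strip Y (y_part (Suc n) f) = y_part n (strip Y f)"
  by (auto simp: strip_def y_part_def)

lemma twist_y_part: "twist q a (y_part n f) = y_part n (twist q a f)"
  by (auto simp: twist_def y_part_def)

lemma y_part_qsh: "y_part n (qsh q f g) w = (\<Sum>i\<le>n. qsh q (y_part i f) (y_part (n - i) g) w)"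
proof (induction w arbitrary: n f g)
  case Nil
  show ?case by (cases n) (simp_all add: y_part_def sum.atMost_Suc_shift)
next
  case (Cons a w)
  have "y_part n (qsh q f g) (a # w) = strip a (y_part n (qsh q f g)) w"
    by (simp add: strip_at)
  also have "\<dots> = (\<Sum>i\<le>n. strip a (qsh q (y_part i f) (y_part (n - i) g)) w)"
  proof (cases a)
    case X
    have "y_part n (strip X (qsh q f g)) w =
      y_part n (qsh q (strip X f) g) w + y_part n (qsh q (twist q X f) (strip X g)) w"
      by (simp add: strip_qsh y_part_def)
    then show ?thesis
      by (simp add: X strip_y_part strip_qsh twist_y_part Cons.IH sum.distrib)
  next
    case Y
    show ?thesis
    proof (cases n)
      case 0
      then show ?thesis by (simp add: Y strip_y_part strip_qsh twist_y_part)
    next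
      case (Suc m)
      have "(\<Sum>i\<le>Suc m. qsh q (strip Y (y_part i f)) (y_part (Suc m - i) g) w) =
        y_part m (qsh q (strip Y f) g) w"
        by (simp add: sum.atMost_Suc_shift strip_y_part Cons.IH del: sum.atMost_Suc)
      moreover have "(\<Sum>i\<le>Suc m. qsh q (y_part i (twist q Y f)) (strip Y (y_part (Suc m - i) g)) w) =
        y_part m (qsh q (twist q Y f) (strip Y g)) w"
        by (simp add: strip_y_part Cons.IH Suc_diff_le)
      moreover have "y_part m (strip Y (qsh q f g)) w =
        y_part m (qsh q (strip Y f) g) w + y_part m (qsh q (twist q Y f) (strip Y g)) w"
        by (simp add: strip_qsh y_part_def)
      ultimately show ?thesis
        by (simp add: Y Suc strip_y_part strip_qsh twist_y_part sum.distrib del: sum.atMost_Suc)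
    qed
  qed
  finally show ?case by (simp add: strip_at)
qed

lemma y_part_alt_series:
  "y_part n (alt_G_series c) w = c ^ n * alt_G n w \<and> y_part n (alt_W_series c) w = c ^ n * alt_W n w"
proof (induction w arbitrary: n)
  case Nil
  show ?case by (simp add: y_part_def alt_simps)
next
  case (Cons a w)
  show ?case
  proof (cases a)
    case X
    then show ?thesis
      using Cons.IH[of n] by (simp flip: strip_at) (simp add: strip_y_part strip_series alt_simps)
  next
    case Y
    then show ?thesis
    proof (cases n)
      case 0
      then show ?thesis using Y by (simp flip: strip_at) (simp add: strip_y_part strip_series alt_simps)
    next
      case (Suc m)
      then show ?thesis
        using Y Cons.IH[of m] by (simp flip: strip_at) (simp add: strip_y_part strip_series alt_simps y_part_scale)
    qed
  qed
qed

lemma height_eq_length: "height w = int (length w) - 2 * int (count_list w Y)"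
proof (induction w)
  case (Cons a w)
  then show ?case by (cases a) simp_all
qed simp

text \<open>
  The product is taken over all prefixes, as in the definition of the Catalan elements. The recursion of
  \<open>catalan_path\<close> omits the factor of the last prefix, which is \<open>[1]_q\<close>.
\<close>
lemma catalan_path_eq_prod:
  fixes q :: "'a::field"
  assumes "qnum q 1 = 1"
  shows "catalan_path q h w = (-1) ^ count_list w Y *
    (if h + height w = 0 \<and> (\<forall>i\<le>length w. 0 \<le> h + height (take i w))
     then \<Prod>i\<le>length w. qnum q (1 + (h + height (take i w))) else 0)"
proof (induction w arbitrary: h)
  case Nil
  show ?case by (simp add: assms)
next
  case (Cons a w)
  define P where "P \<longleftrightarrow> (\<forall>i\<le>length w. 0 \<le> h + bar a + height (take i w))"
  define Q where "Q = (\<Prod>i\<le>length w. qnum q (1 + (h + bar a + height (take i w))))"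
  have all: "(\<forall>i\<le>length (a # w). 0 \<le> h + height (take i (a # w))) \<longleftrightarrow>
      0 \<le> h \<and> P" (is "?L \<longleftrightarrow> ?R")
  proof
    assume L: ?L
    have "0 \<le> h + bar a + height (take i w)" if "i \<le> length w" for i
      using L[rule_format, of "Suc i"] that by simp
    then show ?R using L[rule_format, of 0] by (simp add: P_def)
  next
    assume R: ?R
    show ?L
    proof (intro allI impI)
      fix i assume "i \<le> length (a # w)"
      then show "0 \<le> h + height (take i (a # w))"
        using R by (cases i) (auto simp: P_def add.assoc)
    qed
  qed
  have prod: "(\<Prod>i\<le>length (a # w). qnum q (1 + (h + height (take i (a # w))))) =
      qnum q (h + 1) * Q"
    by (simp add: Q_def prod.atMost_Suc_shift add.assoc add.commute[of 1] del: prod.atMost_Suc)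
  show ?case
  proof (cases "h < 0")
    case True
    then show ?thesis using catalan_path_neg[OF True, of q "a # w"] by (subst all) simp
  next
    case False
    have step: "catalan_path q h (a # w) =
        (if a = Y then -1 else 1) * qnum q (h + 1) * catalan_path q (h + bar a) w"
      by (cases a) simp_all
    have IH: "catalan_path q (h + bar a) w = (-1) ^ count_list w Y *
        (if h + height (a # w) = 0 \<and> P then Q else 0)"
      unfolding Cons.IH[of "h + bar a"] P_def Q_def height_simps add.assoc ..
    have sign: "(-1) ^ count_list (a # w) Y = (if a = Y then -1 else 1) * (-1 :: 'a) ^ count_list w Y"
      by simp
    have "s * n * (u * (if Z \<and> P then r else 0)) = s * u * (if Z \<and> 0 \<le> h \<and> P then n * r else 0)"
      for s n u r :: 'a and Z
      using False by simp
    then show ?thesis unfolding step IH all prod sign .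
  qed
qed

section \<open>From coefficient functions to the q-shuffle algebra\<close>

abbreviation lookup :: "('k \<Rightarrow>\<^sub>0 'a::zero) \<Rightarrow> 'k \<Rightarrow> 'a" where
  "lookup \<equiv> Poly_Mapping.lookup"
abbreviation keys :: "('k \<Rightarrow>\<^sub>0 'a::zero) \<Rightarrow> 'k set" where
  "keys \<equiv> Poly_Mapping.keys"

lemma lookup_word_elt: "lookup (word_elt u) = delta u"
  by (auto simp: word_elt_def delta_def lookup_single when_def)

lemma lookup_catalan_elt:
  assumes "qnum q 1 = 1"
  shows "(-1) ^ n * lookup (catalan_elt q n) w = y_part n (catalan_path q 0) w"
proof -
  have "lookup (catalan_elt q n) w = (\<Sum>u | length u = 2 * n \<and> catalan_word u.
      if w = u then \<Prod>i=0..2 * n. qnum q (1 + height (take i u)) else 0)"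
    by (simp add: catalan_elt_def lookup_sum lookup_scale lookup_word_elt delta_def if_distrib cong: if_cong)
  also have "\<dots> = (if length w = 2 * n \<and> catalan_word w
      then \<Prod>i=0..2 * n. qnum q (1 + height (take i w)) else 0)"
    by (simp add: sum.delta finite_catalan_words)
  finally have 1: "lookup (catalan_elt q n) w = (if length w = 2 * n \<and> catalan_word w
      then \<Prod>i=0..2 * n. qnum q (1 + height (take i w)) else 0)" .
  have 2: "catalan_word w \<longleftrightarrow> height w = 0 \<and> (\<forall>i\<le>length w. 0 \<le> height (take i w))"
  proof -
    have "0 \<le> height (take i w)" if "\<forall>i\<in>{1..length w}. 0 \<le> height (take i w)" "i \<le> length w" for i
      using that by (cases "i = 0") simp_all
    then show ?thesis by (auto simp: catalan_word_def)
  qed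
  show ?thesis
    unfolding 1 2 y_part_def catalan_path_eq_prod[OF assms]
    using height_eq_length[of w] by (auto simp: atMost_atLeast0)
qed

lemma qsh_sum_left: "qsh q (\<lambda>w. \<Sum>i\<in>I. f i w) g = (\<lambda>w. \<Sum>i\<in>I. qsh q (f i) g w)"
  by (induction I rule: infinite_finite_induct) (simp_all add: qsh_add_left)

lemma qsh_sum_right: "qsh q f (\<lambda>w. \<Sum>i\<in>I. g i w) = (\<lambda>w. \<Sum>i\<in>I. qsh q f (g i) w)"
  by (induction I rule: infinite_finite_induct) (simp_all add: qsh_add_right)

lemma lookup_letter_times:
  "lookup (letter_times a f) [] = 0"
  "lookup (letter_times a f) (b # w) = (if a = b then lookup f w else 0)"
proof -
  show "lookup (letter_times a f) [] = 0"
    by (simp add: letter_times_def lookup_sum lookup_single)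
  have "lookup (letter_times a f) (b # w) =
      (\<Sum>u\<in>keys f. if u = w then (if a = b then lookup f w else 0) else 0)"
    unfolding letter_times_def lookup_sum
    by (intro sum.cong) (auto simp: lookup_single when_def)
  then show "lookup (letter_times a f) (b # w) = (if a = b then lookup f w else 0)"
    by (auto simp: sum.delta in_keys_iff)
qed

lemma sum_pairing: "(\<Sum>c\<leftarrow>u. pairing c b) = 2 * bar b * height u"
proof (induction u)
  case (Cons a u)
  then show ?case by (cases a; cases b) simp_all
qed simp

lemma lookup_qshuffle_words: "lookup (qshuffle_words q u v) = qsh q (delta u) (delta v)"
proof (induction q u v rule: qshuffle_words.induct)
  case (3 q a u b v)
  show ?case
  proof
    fix w
    show "lookup (qshuffle_words q (a # u) (b # v)) w = qsh q (delta (a # u)) (delta (b # v)) w"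
    proof (cases w)
      case Nil
      then show ?thesis by (simp add: lookup_add lookup_scale lookup_letter_times delta_def)
    next
      case (Cons c w')
      have "lookup (qshuffle_words q (a # u) (b # v)) w =
          (if a = c then qsh q (delta u) (delta (b # v)) w' else 0) +
          q powi (2 * bar b * height (a # u)) * (if b = c then qsh q (delta (a # u)) (delta v) w' else 0)"
        unfolding Cons qshuffle_words.simps lookup_add lookup_scale lookup_letter_times 3 sum_pairing ..
      also have "\<dots> = strip c (qsh q (delta (a # u)) (delta (b # v))) w'"
        unfolding strip_qsh_homog[OF homog_delta] strip_delta by auto
      finally show ?thesis by (simp add: Cons strip_at)
    qed
  qed
qed (simp_all add: lookup_word_elt qsh_one_left qsh_one_right)

lemma lookup_eq_sum: "lookup f = (\<lambda>w. \<Sum>u\<in>keys f. lookup f u * delta u w)"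
proof
  fix w
  have "(\<Sum>u\<in>keys f. lookup f u * delta u w) = (\<Sum>u\<in>keys f. if u = w then lookup f w else 0)"
    by (intro sum.cong) (auto simp: delta_def)
  then show "lookup f w = (\<Sum>u\<in>keys f. lookup f u * delta u w)"
    by (auto simp: sum.delta in_keys_iff)
qed

text \<open>
  From here on identities between coefficient functions become identities in the q-shuffle algebra.
\<close>
lemma lookup_qshuffle: "lookup (qshuffle q f g) = qsh q (lookup f) (lookup g)"
proof -
  have "qsh q (lookup f) (lookup g) = (\<lambda>w. \<Sum>u\<in>keys f. \<Sum>v\<in>keys g.
      lookup f u * (lookup g v * qsh q (delta u) (delta v) w))"
    by (subst lookup_eq_sum[of f], subst lookup_eq_sum[of g])
      (simp add: qsh_sum_left qsh_sum_right qsh_scale_left qsh_scale_right sum_distrib_left)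
  then show ?thesis
    by (simp add: qshuffle_def fun_eq_iff lookup_sum lookup_scale lookup_qshuffle_words mult.assoc)
qed

lemma qshuffle_linear:
  "qshuffle q (f + f') g = qshuffle q f g + qshuffle q f' g"
  "qshuffle q f (g + g') = qshuffle q f g + qshuffle q f g'"
  "qshuffle q (scale c f) g = scale c (qshuffle q f g)"
  "qshuffle q f (scale c g) = scale c (qshuffle q f g)"
proof -
  have add: "lookup (f + g) = (\<lambda>w. lookup f w + lookup g w)" for f g :: "'a vv"
    by (simp add: fun_eq_iff lookup_add)
  have scale: "lookup (scale c f) = (\<lambda>w. c * lookup f w)" for f :: "'a vv"
    by (simp add: fun_eq_iff lookup_scale)
  show "qshuffle q (f + f') g = qshuffle q f g + qshuffle q f' g"
    "qshuffle q f (g + g') = qshuffle q f g + qshuffle q f g'"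
    "qshuffle q (scale c f) g = scale c (qshuffle q f g)"
    "qshuffle q f (scale c g) = scale c (qshuffle q f g)"
    by (simp_all add: poly_mapping_eq_iff lookup_qshuffle add scale
      qsh_add_left qsh_add_right qsh_scale_left qsh_scale_right)
qed

lemma qshuffle_one:
  "qshuffle q (word_elt []) f = f" "qshuffle q f (word_elt []) = f"
  by (simp_all add: poly_mapping_eq_iff lookup_qshuffle lookup_word_elt qsh_one_left qsh_one_right)

lemma qshuffle_assoc:
  "q \<noteq> 0 \<Longrightarrow> qshuffle q (qshuffle q f g) h = qshuffle q f (qshuffle q g h)"
  by (simp add: poly_mapping_eq_iff lookup_qshuffle qsh_assoc)

definition xy_word :: "nat \<Rightarrow> 'a::field vv" where
  "xy_word n = word_elt (concat (replicate n [X, Y]))"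

lemma lookup_xy_word: "lookup (xy_word n) = alt_G n"
  by (simp add: xy_word_def alt_G_def lookup_word_elt)

lemma xy_word_0: "xy_word 0 = word_elt []"
  by (simp add: xy_word_def)

lemma xy_word_commute:
  "q \<noteq> 0 \<Longrightarrow> qshuffle q (xy_word m) (xy_word n) = qshuffle q (xy_word n) (xy_word m)"
  using alt_relations[of q m n] by (simp add: poly_mapping_eq_iff lookup_qshuffle lookup_xy_word fun_eq_iff)

text \<open>
  The degree \<open>n\<close> part of \<open>G(q t) \<star> G(t / q)\<close>.
\<close>
definition xy_conv :: "'a::field \<Rightarrow> nat \<Rightarrow> 'a vv" where
  "xy_conv q n = (\<Sum>i\<le>n. scale (q ^ i * inverse q ^ (n - i)) (qshuffle q (xy_word i) (xy_word (n - i))))"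

lemma catalan_xy_conv:
  fixes q :: "'a::field"
  assumes q0: "q \<noteq> 0" and q2: "q ^ 2 \<noteq> 1"
  shows "(\<Sum>i\<le>n. scale ((-1) ^ i) (qshuffle q (catalan_elt q i) (xy_conv q (n - i)))) =
    (if n = 0 then word_elt [] else 0)"
proof (rule poly_mapping_eqI)
  fix w
  have qnum1: "qnum q 1 = 1"
    using q0 q2 by (simp add: qnum_def field_simps power2_eq_square)
  have xy_conv: "lookup (xy_conv q m) = y_part m (alt_pair0 q)" for m
  proof
    fix w
    have "y_part k (alt_G_series c) = (\<lambda>w. c ^ k * alt_G k w)" for k and c :: 'a
      using y_part_alt_series by auto
    then show "lookup (xy_conv q m) w = y_part m (alt_pair0 q) w"
      by (simp add: alt_pair0_def y_part_qsh xy_conv_def lookup_sum lookup_scale lookup_qshuffle lookup_xy_word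
        qsh_scale_left qsh_scale_right mult.assoc)
  qed
  have "lookup (\<Sum>i\<le>n. scale ((-1) ^ i) (qshuffle q (catalan_elt q i) (xy_conv q (n - i)))) w =
      (\<Sum>i\<le>n. qsh q (\<lambda>w. (-1) ^ i * lookup (catalan_elt q i) w) (y_part (n - i) (alt_pair0 q)) w)"
    by (simp add: lookup_sum lookup_scale lookup_qshuffle xy_conv qsh_scale_left)
  also have "\<dots> = y_part n (qsh q (catalan_path q 0) (alt_pair0 q)) w"
    by (simp add: lookup_catalan_elt[OF qnum1] y_part_qsh)
  also have "\<dots> = y_part n (delta []) w"
    by (simp add: catalan_path_qsh_alt_pair0[OF q0 q2])
  also have "\<dots> = lookup (if n = 0 then word_elt [] else 0) w"
    by (auto simp: y_part_def lookup_word_elt delta_def)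
  finally show "lookup (\<Sum>i\<le>n. scale ((-1) ^ i) (qshuffle q (catalan_elt q i) (xy_conv q (n - i)))) w =
      lookup (if n = 0 then word_elt [] else 0) w" .
qed

section \<open>Independent families and monomials\<close>

interpretation pm: vector_space "scale :: 'a::field \<Rightarrow> ('k \<Rightarrow>\<^sub>0 'a) \<Rightarrow> ('k \<Rightarrow>\<^sub>0 'a)"
  by unfold_locales (simp_all add: poly_mapping_eq_iff fun_eq_iff lookup_scale lookup_add distrib_left distrib_right mult.assoc)

definition extend :: "('m \<Rightarrow> ('k \<Rightarrow>\<^sub>0 'a)) \<Rightarrow> ('m \<Rightarrow>\<^sub>0 'a::field) \<Rightarrow> ('k \<Rightarrow>\<^sub>0 'a)" where
  "extend B p = (\<Sum>m\<in>keys p. scale (lookup p m) (B m))"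

text \<open>
  Independence as a family, so that it includes injectivity of the indexing.
\<close>
definition independent_family :: "('m \<Rightarrow> ('k \<Rightarrow>\<^sub>0 'a::field)) \<Rightarrow> bool" where
  "independent_family B \<longleftrightarrow>
    (\<forall>K c. finite K \<longrightarrow> (\<Sum>m\<in>K. scale (c m) (B m)) = 0 \<longrightarrow> (\<forall>m\<in>K. c m = 0))"

lemma independent_familyD:
  assumes "independent_family B" "finite K" "(\<Sum>m\<in>K. scale (c m) (B m)) = 0" "m \<in> K"
  shows "c m = 0"
  using assms(1)[unfolded independent_family_def, THEN spec[of _ K], THEN spec[of _ c]] assms(2-4)
  by simp

lemma extend_superset:
  "finite K \<Longrightarrow> keys p \<subseteq> K \<Longrightarrow> extend B p = (\<Sum>m\<in>K. scale (lookup p m) (B m))"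
  unfolding extend_def by (rule sum.mono_neutral_left) (auto simp: in_keys_iff)

lemma extend_add: "extend B (p + p') = extend B p + extend B p'"
  using extend_superset[of "keys p \<union> keys p'" "p + p'" B]
    extend_superset[of "keys p \<union> keys p'" p B] extend_superset[of "keys p \<union> keys p'" p' B]
    keys_add[of p p']
  by (simp add: lookup_add pm.scale_left_distrib sum.distrib)

lemma extend_scale: "extend B (scale c p) = scale c (extend B p)"
proof -
  have "keys (scale c p) \<subseteq> keys p" by (auto simp: in_keys_iff lookup_scale)
  then show ?thesis
    using extend_superset[of "keys p" "scale c p" B]
    by (simp add: lookup_scale extend_def pm.scale_sum_right)
qed

lemma extend_zero [simp]: "extend B 0 = 0"
  by (simp add: extend_def)

lemma extend_single: "extend B (Poly_Mapping.single m c) = scale c (B m)"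
  using extend_superset[of "{m}" "Poly_Mapping.single m c" B] by simp

lemma extend_sum: "extend B (\<Sum>i\<in>I. p i) = (\<Sum>i\<in>I. extend B (p i))"
  by (induction I rule: infinite_finite_induct) (simp_all add: extend_add)

lemma extend_eq_0:
  assumes "independent_family B" and "extend B p = 0"
  shows "p = 0"
proof (rule poly_mapping_eqI)
  have "\<forall>m\<in>keys p. lookup p m = 0"
    using independent_familyD[OF assms(1) finite_keys assms(2)[unfolded extend_def]] by simp
  then show "lookup p k = lookup 0 k" for k
    by (cases "k \<in> keys p") (auto simp: in_keys_iff)
qed

lemma inj_extend: "independent_family B \<Longrightarrow> inj (extend B)"
proof (rule injI)
  fix p p' assume B: "independent_family B" and "extend B p = extend B p'"
  then have "extend B (p - p') = 0"
    using extend_add[of B "p - p'" p'] by simp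
  then have "p - p' = 0" by (rule extend_eq_0[OF B])
  then show "p = p'" by simp
qed

lemma independent_family_comp:
  assumes B: "independent_family B" and s: "inj s"
  shows "independent_family (\<lambda>m. B (s m))"
  unfolding independent_family_def
proof (intro allI impI)
  fix K c assume K: "finite K" and 0: "(\<Sum>m\<in>K. scale (c m) (B (s m))) = 0"
  have "(\<Sum>m\<in>s ` K. scale (c (inv s m)) (B m)) = 0"
    using 0 by (simp add: sum.reindex[OF inj_on_subset[OF s subset_UNIV]] inv_f_f[OF s])
  then have "c (inv s m) = 0" if "m \<in> s ` K" for m
    using that K by (intro independent_familyD[OF B, where c = "\<lambda>m. c (inv s m)"]) simp_all
  then show "\<forall>m\<in>K. c m = 0" using inv_f_f[OF s] by (metis imageI)
qed

lemma poly_mapping_eq_sum_single: "p = (\<Sum>m\<in>keys p. Poly_Mapping.single m (lookup p m))"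
proof (rule poly_mapping_eqI)
  fix k
  have "lookup (\<Sum>m\<in>keys p. Poly_Mapping.single m (lookup p m)) k =
      (\<Sum>m\<in>keys p. if m = k then lookup p k else 0)"
    unfolding lookup_sum by (intro sum.cong) (auto simp: lookup_single)
  then show "lookup p k = lookup (\<Sum>m\<in>keys p. Poly_Mapping.single m (lookup p m)) k"
    by (auto simp: sum.delta in_keys_iff)
qed

lemma span_image_extend:
  assumes "f \<in> pm.span (B ` S)"
  obtains p where "keys p \<subseteq> S" "f = extend B p"
proof -
  have "\<exists>p. keys p \<subseteq> S \<and> f = extend B p"
    using assms
  proof (induction rule: pm.span_induct_alt)
    case base
    show ?case by (rule exI[of _ 0]) simp
  next
    case (step c x y)
    then obtain m p where m: "m \<in> S" "x = B m" and p: "keys p \<subseteq> S" "y = extend B p" by auto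
    have "keys (Poly_Mapping.single m c + p) \<subseteq> S"
      using keys_add[of "Poly_Mapping.single m c" p] m p by (auto split: if_splits)
    then show ?case using m p
      by (intro exI[of _ "Poly_Mapping.single m c + p"]) (simp add: extend_add extend_single)
  qed
  then show ?thesis using that by blast
qed

lemma qshuffle_zero [simp]: "qshuffle q 0 g = 0" "qshuffle q f 0 = 0"
  by (simp_all add: qshuffle_def)

lemma qshuffle_sum:
  "qshuffle q (\<Sum>i\<in>I. f i) g = (\<Sum>i\<in>I. qshuffle q (f i) g)"
  "qshuffle q f' (\<Sum>i\<in>I. g' i) = (\<Sum>i\<in>I. qshuffle q f' (g' i))"
  by (induction I rule: infinite_finite_induct) (simp_all add: qshuffle_linear)

lemma span_qshuffle:
  assumes "f \<in> pm.span A" "g \<in> pm.span B"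
    and AB: "\<And>a b. a \<in> A \<Longrightarrow> b \<in> B \<Longrightarrow> qshuffle q a b \<in> pm.span C"
  shows "qshuffle q f g \<in> pm.span C"
  using assms(1)
proof (induction rule: pm.span_induct_alt)
  case (step c a f)
  have "qshuffle q a g \<in> pm.span C"
    using assms(2)
    by (induction rule: pm.span_induct_alt)
      (simp_all add: qshuffle_linear pm.span_zero pm.span_add pm.span_scale AB step.hyps)
  then show ?case
    using step by (simp add: qshuffle_linear pm.span_add pm.span_scale)
qed (simp add: pm.span_zero)

text \<open>
  Because the q-shuffle product depends on \<open>q\<close>, it is not the multiplication of a type; monomials in
  commuting elements are therefore formed by folding over multisets of indices.
\<close>
locale commuting_family =
  fixes q :: "'a::field" and g :: "nat \<Rightarrow> 'a vv"
  assumes q0: "q \<noteq> 0"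
    and commute: "qshuffle q (g i) (g j) = qshuffle q (g j) (g i)"
begin

definition mon :: "nat multiset \<Rightarrow> 'a vv" where
  "mon M = fold_mset (\<lambda>i. qshuffle q (g i)) (word_elt []) M"

sublocale comp_fun_commute "\<lambda>i. qshuffle q (g i)"
  by unfold_locales (simp add: fun_eq_iff commute flip: qshuffle_assoc[OF q0])

lemma mon_empty [simp]: "mon {#} = word_elt []"
  by (simp add: mon_def)

lemma mon_add_mset: "mon (add_mset i M) = qshuffle q (g i) (mon M)"
  by (simp add: mon_def)

lemma mon_union: "qshuffle q (mon M) (mon N) = mon (M + N)"
  by (induction M) (simp_all add: qshuffle_one mon_add_mset qshuffle_assoc q0)

lemma span_mon_commute:
  assumes "f \<in> pm.span (range mon)" "f' \<in> pm.span (range mon)"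
  shows "qshuffle q f f' = qshuffle q f' f"
  using assms(1)
proof (induction rule: pm.span_induct_alt)
  case (step c a f)
  have "qshuffle q a f' = qshuffle q f' a"
    using assms(2)
    by (induction rule: pm.span_induct_alt)
      (use step.hyps in \<open>auto simp: qshuffle_linear mon_union add.commute\<close>)
  then show ?case using step by (simp add: qshuffle_linear)
qed simp

abbreviation span_ge :: "nat \<Rightarrow> 'a vv set" where
  "span_ge d \<equiv> pm.span (mon ` {M. d \<le> size M})"

lemma qshuffle_span_ge:
  "f \<in> span_ge d \<Longrightarrow> f' \<in> span_ge e \<Longrightarrow> qshuffle q f f' \<in> span_ge (d + e)"
  by (erule (1) span_qshuffle) (auto simp: mon_union intro!: pm.span_base)

lemma span_ge_mono: "d \<le> e \<Longrightarrow> f \<in> span_ge e \<Longrightarrow> f \<in> span_ge d"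
  by (rule set_mp[OF pm.span_mono]) auto

lemma mon_span_ge: "d \<le> size M \<Longrightarrow> mon M \<in> span_ge d"
  by (auto intro: pm.span_base)

lemma gen_span_ge: "g i \<in> span_ge 1"
  using mon_span_ge[of 1 "{#i#}"] by (simp add: mon_add_mset qshuffle_one)

end

text \<open>
  Triangularity with respect to the size of multisets: in a linear relation among the \<open>C M\<close>,
  the coefficients at multisets of smallest size are the only contributions to the \<open>B M\<close> of that size.
\<close>
lemma independent_family_leading_term:
  fixes B C :: "nat multiset \<Rightarrow> ('k \<Rightarrow>\<^sub>0 'a::field)"
  assumes B: "independent_family B"
    and C: "\<And>M. C M - scale (\<gamma> M) (B M) \<in> pm.span (B ` {N. Suc (size M) \<le> size N})"
    and \<gamma>: "\<And>M. \<gamma> M \<noteq> 0"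
  shows "independent_family C"
  unfolding independent_family_def
proof (intro allI impI ballI, rule ccontr)
  fix K c M1
  assume K: "finite K" and 0: "(\<Sum>M\<in>K. scale (c M) (C M)) = 0" and M1: "M1 \<in> K" "c M1 \<noteq> 0"
  have "\<exists>p. keys p \<subseteq> {N. Suc (size M) \<le> size N} \<and> C M - scale (\<gamma> M) (B M) = extend B p" for M
    using span_image_extend[OF C[of M]] by metis
  then obtain r where r: "\<And>M. keys (r M) \<subseteq> {N. Suc (size M) \<le> size N}"
    "\<And>M. C M - scale (\<gamma> M) (B M) = extend B (r M)" by metis
  have C_eq: "C M = extend B (Poly_Mapping.single M (\<gamma> M) + r M)" for M
    using r(2)[of M] by (simp add: extend_add extend_single algebra_simps)
  define K' where "K' = {M \<in> K. c M \<noteq> 0}"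
  obtain M0 where M0: "M0 \<in> K'" and min: "\<And>M. M \<in> K' \<Longrightarrow> size M0 \<le> size M"
  proof -
    have K': "finite (size ` K')" "size ` K' \<noteq> {}" using K M1 by (auto simp: K'_def)
    then have "Min (size ` K') \<in> size ` K'" by (rule Min_in)
    then obtain M0 where "M0 \<in> K'" "Min (size ` K') = size M0" by auto
    moreover have "Min (size ` K') \<le> size M" if "M \<in> K'" for M
      using K' that by (intro Min_le) auto
    ultimately show ?thesis using that by auto
  qed
  define P where "P = (\<Sum>M\<in>K. scale (c M) (Poly_Mapping.single M (\<gamma> M) + r M))"
  have "extend B P = 0"
    using 0 by (simp add: P_def extend_sum extend_scale C_eq)
  then have "P = 0" by (rule extend_eq_0[OF B])
  moreover have "lookup P M0 = c M0 * \<gamma> M0"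
  proof -
    have "lookup (r M) M0 = 0" if "M \<in> K'" for M
      using r(1)[of M] min[OF that] by (auto simp flip: not_in_keys_iff_lookup_eq_zero)
    then have "c M * lookup (Poly_Mapping.single M (\<gamma> M) + r M) M0 =
        (if M = M0 then c M0 * \<gamma> M0 else 0)" if "M \<in> K" for M
      using that by (cases "c M = 0") (auto simp: lookup_add lookup_single K'_def when_def)
    then show ?thesis
      using M0 K by (simp add: P_def lookup_sum lookup_scale K'_def sum.delta)
  qed
  ultimately show False
    using M0 \<gamma>[of M0] by (simp add: K'_def)
qed

section \<open>Algebraic independence of the alternating words\<close>

text \<open>
  The index \<open>i\<close> stands for the word \<open>G (i + 1)\<close>, so \<open>lower\<close> replaces each word
  \<open>G n\<close> of a monomial by \<open>G (n - 1)\<close> and drops the words that have become trivial.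
\<close>
definition lower :: "nat multiset \<Rightarrow> nat multiset" where
  "lower M = image_mset (\<lambda>i. i - 1) (filter_mset (\<lambda>i. i \<noteq> 0) M)"

lemma lower_simps [simp]:
  "lower {#} = {#}" "lower (add_mset 0 M) = lower M" "lower (add_mset (Suc i) M) = add_mset i (lower M)"
  by (simp_all add: lower_def)

lemma lower_inverse: "image_mset Suc (lower M) + replicate_mset (size M - size (lower M)) 0 = M \<and>
    size (lower M) \<le> size M"
proof (induction M)
  case (add i M)
  then show ?case by (cases i) (auto simp: Suc_diff_le)
qed simp

text \<open>
  The number of dropped words is recovered from the size.
\<close>
lemma lower_inj: "lower M = lower N \<Longrightarrow> size M = size N \<Longrightarrow> M = N"
  using lower_inverse[of M] lower_inverse[of N] by metis

lemma sum_Suc_lower: "(\<Sum>i\<in>#lower M. Suc i) + size M = (\<Sum>i\<in>#M. Suc i)"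
proof (induction M)
  case (add i M)
  then show ?case by (cases i) simp_all
qed simp

lemma strip_pow_sum:
  "(strip a ^^ k) (\<lambda>w. \<Sum>i\<in>I. f i w) = (\<lambda>w. \<Sum>i\<in>I. (strip a ^^ k) (f i) w)"
  for f :: "'i \<Rightarrow> word \<Rightarrow> 'a::field"
  by (induction I rule: infinite_finite_induct) (simp_all add: strip_pow_linear)

locale non_root_of_unity =
  fixes q :: "'a::field"
  assumes q0: "q \<noteq> 0" and not_root: "\<And>n::nat. n \<ge> 1 \<Longrightarrow> q ^ n \<noteq> 1"
begin

sublocale xy: commuting_family q "\<lambda>i. xy_word (Suc i)"
  by unfold_locales (simp_all add: q0 xy_word_commute)

lemma q2: "q ^ 2 \<noteq> 1"
  using not_root[of 2] by simp

text \<open>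
  Up to a power of \<open>q\<close> these sums are q-integers.
\<close>
lemma geometric_sum_nonzero:
  "(\<Sum>i<Suc k. (q powi (-2)) ^ i) \<noteq> 0" "(\<Sum>i<Suc k. (q ^ 2) ^ i) \<noteq> 0"
proof -
  have q_ne: "(q ^ 2) ^ Suc k \<noteq> 1" unfolding power_mult[symmetric] by (rule not_root) simp
  then show "(\<Sum>i<Suc k. (q ^ 2) ^ i) \<noteq> 0"
    using geometric_sum[OF q2, of "Suc k"] q2 by (simp add: divide_eq_0_iff del: sum.lessThan_Suc power_Suc)
  have eq: "q powi (-2) = inverse (q ^ 2)" by (simp add: power_int_minus)
  have "inverse (q ^ 2) \<noteq> 1" "inverse (q ^ 2) ^ Suc k \<noteq> 1"
    using q2 q_ne by (simp_all add: power_inverse del: power_Suc)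
  then show "(\<Sum>i<Suc k. (q powi (-2)) ^ i) \<noteq> 0"
    unfolding eq using geometric_sum[of "inverse (q ^ 2)" "Suc k"]
    by (simp add: divide_eq_0_iff del: sum.lessThan_Suc power_Suc)
qed

lemma peels_to_mon: "\<exists>c. c \<noteq> 0 \<and> peels_to (size M) (lookup (xy.mon M)) c (lookup (xy.mon (lower M)))"
proof (induction M)
  case empty
  show ?case by (intro exI[of _ 1]) (simp add: lookup_word_elt peels_to_one)
next
  case (add i M)
  then obtain c where "c \<noteq> 0" and c: "peels_to (size M) (lookup (xy.mon M)) c (lookup (xy.mon (lower M)))"
    by blast
  have "qsh q (alt_G i) (lookup (xy.mon (lower M))) = lookup (xy.mon (lower (add_mset i M)))"
    by (cases i) (simp_all add: alt_simps qsh_one_left xy.mon_add_mset lookup_qshuffle lookup_xy_word)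
  with peels_to_alt_G[OF c, of q i] geometric_sum_nonzero[of "size M"] \<open>c \<noteq> 0\<close>
  show ?case
    by (intro exI[of _ "(\<Sum>i<Suc (size M). (q powi (-2)) ^ i) * (\<Sum>i<Suc (size M). (q ^ 2) ^ i) * c"])
      (simp add: xy.mon_add_mset lookup_qshuffle lookup_xy_word del: sum.lessThan_Suc)
qed

text \<open>
  Removing the prefix \<open>x^r y^r\<close>, where \<open>r\<close> is the largest number of factors in a linear relation,
  kills all monomials with fewer factors and sends the others to nonzero multiples of distinct
  monomials of smaller degree. Induction on the degree then shows that their coefficients are zero.
\<close>
lemma independent_family_xy_mon: "independent_family xy.mon"
proof -
  obtain \<kappa> where \<kappa>: "\<And>M. \<kappa> M \<noteq> 0"
    "\<And>M. peels_to (size M) (lookup (xy.mon M)) (\<kappa> M) (lookup (xy.mon (lower M)))"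
    using peels_to_mon by metis
  have "\<forall>M\<in>K. c M = 0"
    if "finite K" "(\<Sum>M\<in>K. scale (c M) (xy.mon M)) = 0" "\<And>M. M \<in> K \<Longrightarrow> (\<Sum>i\<in>#M. Suc i) < d"
    for K c d
    using that
  proof (induction d arbitrary: K c)
    case (Suc d)
    show ?case
    proof (rule ccontr)
      define K' where "K' = {M \<in> K. c M \<noteq> 0}"
      assume "\<not> (\<forall>M\<in>K. c M = 0)"
      then have K': "finite K'" "K' \<noteq> {}" using Suc.prems by (auto simp: K'_def)
      have "(\<Sum>M\<in>K'. scale (c M) (xy.mon M)) = (\<Sum>M\<in>K. scale (c M) (xy.mon M))"
        using Suc.prems by (intro sum.mono_neutral_left) (auto simp: K'_def)
      then have sum0: "(\<Sum>M\<in>K'. scale (c M) (xy.mon M)) = 0" using Suc.prems by simp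
      define r where "r = Max (size ` K')"
      have size_le: "size M \<le> r" if "M \<in> K'" for M
        using that K' by (simp add: r_def)
      obtain M0 where M0: "M0 \<in> K'" "size M0 = r"
      proof -
        have "r \<in> size ` K'" unfolding r_def using K' by (intro Max_in) auto
        then show ?thesis using that by blast
      qed
      \<comment> \<open>This makes the degree drop: each of the \<open>r\<close> factors loses one.\<close>
      have "r \<noteq> 0"
      proof
        assume "r = 0"
        then have "K' = {{#}}" using size_le M0 by auto
        moreover have "word_elt [] \<noteq> (0 :: 'a vv)"
          by (metis lookup_single_eq lookup_zero word_elt_def zero_neq_one)
        ultimately show False using sum0 M0 by (auto simp: K'_def)
      qed
      define T where "T f = (strip Y ^^ r) ((strip X ^^ r) f)" for f :: "word \<Rightarrow> 'a"
      have T_mon: "T (lookup (xy.mon M)) =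
          (\<lambda>w. (if size M = r then \<kappa> M else 0) * lookup (xy.mon (lower M)) w)" if "M \<in> K'" for M
      proof (cases "size M = r")
        case True
        then show ?thesis using \<kappa>(2)[of M] by (simp add: peels_to_def T_def)
      next
        case False
        then have "r = (r - Suc (size M)) + Suc (size M)" using size_le[OF that] by simp
        then have "(strip X ^^ r) (lookup (xy.mon M)) = (\<lambda>w. 0)"
          using \<kappa>(2)[of M] unfolding peels_to_def by (metis comp_apply funpow_add strip_pow_zero)
        then show ?thesis using False by (simp add: T_def)
      qed
      \<comment> \<open>On the monomials with \<open>r\<close> factors \<open>lower\<close> is injective, so no terms of the lowered relation
        merge.\<close>
      define R where "R = {M \<in> K'. size M = r}"
      have inj: "inj_on lower R" by (auto simp: inj_on_def R_def intro: lower_inj)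
      have "(\<Sum>M\<in>R. scale (c M * \<kappa> M) (xy.mon (lower M))) = 0"
      proof (rule poly_mapping_eqI)
        fix w
        have "lookup (\<Sum>M\<in>R. scale (c M * \<kappa> M) (xy.mon (lower M))) w =
            (\<Sum>M\<in>K'. c M * T (lookup (xy.mon M)) w)"
          unfolding lookup_sum R_def
          by (intro sum.mono_neutral_cong_left)
            (auto simp: K' T_mon lookup_scale)
        also have "\<dots> = T (lookup (\<Sum>M\<in>K'. scale (c M) (xy.mon M))) w"
        proof -
          have "lookup (\<Sum>M\<in>K'. scale (c M) (xy.mon M)) = (\<lambda>w. \<Sum>M\<in>K'. c M * lookup (xy.mon M) w)"
            by (simp add: fun_eq_iff lookup_sum lookup_scale)
          then show ?thesis by (simp add: T_def strip_pow_sum strip_pow_linear)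
        qed
        also have "\<dots> = 0"
        proof -
          have "lookup (0 :: 'a vv) = (\<lambda>w. 0)" by (simp add: fun_eq_iff)
          then show ?thesis by (simp add: sum0 T_def)
        qed
        finally show "lookup (\<Sum>M\<in>R. scale (c M * \<kappa> M) (xy.mon (lower M))) w = lookup 0 w" by simp
      qed
      then have "(\<Sum>N\<in>lower ` R. scale ((\<lambda>M. c M * \<kappa> M) (inv_into R lower N)) (xy.mon N)) = 0"
        by (simp add: sum.reindex[OF inj] inj)
      moreover have "(\<Sum>i\<in>#N. Suc i) < d" if N: "N \<in> lower ` R" for N
      proof -
        obtain M where "M \<in> R" "N = lower M" using N by blast
        then show ?thesis
          using sum_Suc_lower[of M] Suc.prems(3)[of M] \<open>r \<noteq> 0\<close> by (auto simp: R_def K'_def)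
      qed
      moreover have "finite (lower ` R)" using K' by (simp add: R_def)
      ultimately have "\<forall>N\<in>lower ` R. (\<lambda>M. c M * \<kappa> M) (inv_into R lower N) = 0"
        by (intro Suc.IH)
      moreover have "M0 \<in> R" using M0 by (simp add: R_def)
      ultimately have "(\<lambda>M. c M * \<kappa> M) (inv_into R lower (lower M0)) = 0" by blast
      then have "c M0 * \<kappa> M0 = 0" by (simp add: inv_into_f_f[OF inj \<open>M0 \<in> R\<close>])
      then show False using M0 \<kappa>(1)[of M0] by (simp add: K'_def)
    qed
  qed blast
  note indep = this
  show ?thesis
    unfolding independent_family_def
  proof (intro allI impI)
    fix K c assume "finite K" "(\<Sum>m\<in>K. scale (c m) (xy.mon m)) = 0"
    then show "\<forall>m\<in>K. c m = 0"
      by (rule indep[where d = "Suc (Max ((\<lambda>M. \<Sum>i\<in>#M. Suc i) ` K))"]) (simp add: \<open>finite K\<close> less_Suc_eq_le)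
  qed
qed

section \<open>Catalan elements in terms of alternating words\<close>

text \<open>
  The coefficient of \<open>G n\<close> in \<open>C n\<close> modulo products of at least two alternating words.
\<close>
definition lead_coef :: "nat \<Rightarrow> 'a" where
  "lead_coef n = - ((-1) ^ n) * (q ^ n + inverse q ^ n)"

lemma lead_coef_nonzero:
  assumes "n \<ge> 1"
  shows "lead_coef n \<noteq> 0"
proof
  assume "lead_coef n = 0"
  then have "q ^ n + inverse q ^ n = 0" by (simp add: lead_coef_def)
  then have "q ^ n * q ^ n = - 1" using q0 by (simp add: field_simps eq_neg_iff_add_eq_0)
  moreover have "q ^ (4 * n) = (q ^ n * q ^ n) * (q ^ n * q ^ n)"
  proof -
    have "4 * n = n + n + (n + n)" by simp
    then show ?thesis by (simp only: power_add)
  qed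
  \<comment> \<open>The exponent \<open>4 * n\<close> covers characteristic two as well.\<close>
  ultimately have "q ^ (4 * n) = 1" by simp
  then show False using not_root[of "4 * n"] assms by simp
qed

lemma sum_split_ends:
  fixes f :: "nat \<Rightarrow> 'b::comm_monoid_add"
  assumes "n \<ge> 1"
  shows "(\<Sum>i\<le>n. f i) = f 0 + f n + (\<Sum>i\<in>{0<..<n}. f i)"
proof -
  have "{..n} = insert 0 (insert n {0<..<n})" using assms by auto
  then show ?thesis using assms by (simp add: add.assoc)
qed

lemma xy_word_span: "n \<ge> 1 \<Longrightarrow> xy_word n \<in> xy.span_ge 1"
  using xy.gen_span_ge[of "n - 1"] by simp

text \<open>
  Only the two extreme terms of the convolution contain a factor \<open>G 0 = 1\<close>.
\<close>
lemma xy_conv_span: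
  assumes "n \<ge> 1"
  shows "xy_conv q n - scale (q ^ n + inverse q ^ n) (xy_word n) \<in> xy.span_ge 2"
proof -
  have "xy_conv q n - scale (q ^ n + inverse q ^ n) (xy_word n) =
    (\<Sum>i\<in>{0<..<n}. scale (q ^ i * inverse q ^ (n - i)) (qshuffle q (xy_word i) (xy_word (n - i))))"
    by (simp add: xy_conv_def sum_split_ends[OF assms] xy_word_0 qshuffle_one pm.scale_left_distrib)
  moreover have "qshuffle q (xy_word i) (xy_word (n - i)) \<in> xy.span_ge 2" if "i \<in> {0<..<n}" for i
  proof -
    have "i \<ge> 1" "n - i \<ge> 1" using that by auto
    then show ?thesis
      using xy.qshuffle_span_ge[OF xy_word_span xy_word_span, of i "n - i"] by (simp add: numeral_2_eq_2)
  qed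
  ultimately show ?thesis by (auto intro!: pm.span_sum pm.span_scale)
qed

lemma catalan_elt_0: "catalan_elt q 0 = word_elt []"
  using catalan_xy_conv[OF q0 q2, of 0] by (simp add: xy_conv_def xy_word_0 qshuffle_one)

text \<open>
  Solve \<open>C(-t) \<star> G(q t) \<star> G(t / q) = 1\<close> for \<open>C n\<close>: by induction all terms except the
  one with \<open>C 0 = 1\<close> are products of two elements without constant term.
\<close>
lemma catalan_elt_span:
  "n \<ge> 1 \<Longrightarrow> catalan_elt q n - scale (lead_coef n) (xy_word n) \<in> xy.span_ge 2"
proof (induction n rule: less_induct)
  case (less n)
  have span1: "f \<in> xy.span_ge 1" if "f - scale c (xy_word k) \<in> xy.span_ge 2" "k \<ge> 1" for f c k
  proof -
    have "f - scale c (xy_word k) + scale c (xy_word k) \<in> xy.span_ge 1"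
      using xy.span_ge_mono[OF _ that(1), of 1] xy_word_span[OF that(2)]
      by (intro pm.span_add pm.span_scale) simp_all
    then show ?thesis by simp
  qed
  define mid where
    "mid = (\<Sum>i\<in>{0<..<n}. scale ((-1) ^ i) (qshuffle q (catalan_elt q i) (xy_conv q (n - i))))"
  have mid: "mid \<in> xy.span_ge 2"
  proof -
    have "qshuffle q (catalan_elt q i) (xy_conv q (n - i)) \<in> xy.span_ge 2" if i: "i \<in> {0<..<n}" for i
    proof -
      have "n - i \<ge> 1" using i by auto
      then have "xy_conv q (n - i) \<in> xy.span_ge 1" using span1[OF xy_conv_span] by blast
      moreover have "catalan_elt q i \<in> xy.span_ge 1" using span1[OF less.IH[of i]] i by simp
      ultimately show ?thesis using xy.qshuffle_span_ge[of _ 1 _ 1] by (simp add: numeral_2_eq_2)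
    qed
    then show ?thesis unfolding mid_def by (intro pm.span_sum pm.span_scale)
  qed
  have xy_conv_0: "xy_conv q 0 = word_elt []" by (simp add: xy_conv_def xy_word_0 qshuffle_one)
  have "xy_conv q n + scale ((-1) ^ n) (catalan_elt q n) + mid = 0"
    using catalan_xy_conv[OF q0 q2, of n] less.prems
    by (simp add: sum_split_ends catalan_elt_0 qshuffle_one mid_def xy_conv_0)
  then have "scale ((-1) ^ n) (catalan_elt q n) = - (xy_conv q n + mid)"
    by (metis add.commute add.left_commute eq_neg_iff_add_eq_0)
  then have "scale ((-1) ^ n * (-1) ^ n) (catalan_elt q n) = scale (- ((-1) ^ n)) (xy_conv q n + mid)"
    by (metis pm.scale_scale pm.scale_minus_left pm.scale_minus_right)
  then have "catalan_elt q n = scale (- ((-1) ^ n)) (xy_conv q n + mid)"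
    by (simp flip: power_mult_distrib)
  then have "catalan_elt q n - scale (lead_coef n) (xy_word n) =
      scale (- ((-1) ^ n)) ((xy_conv q n - scale (q ^ n + inverse q ^ n) (xy_word n)) + mid)"
    by (simp add: lead_coef_def pm.scale_right_distrib pm.scale_right_diff_distrib)
  then show ?case
    using pm.span_scale[OF pm.span_add[OF xy_conv_span[OF less.prems] mid]] by (simp only:)
qed

text \<open>
  The Catalan elements lie in the span of the monomials in the commuting alternating words.
\<close>
lemma catalan_elt_commute:
  assumes "m \<ge> 1" "n \<ge> 1"
  shows "qshuffle q (catalan_elt q m) (catalan_elt q n) = qshuffle q (catalan_elt q n) (catalan_elt q m)"
proof -
  have "catalan_elt q k \<in> pm.span (range xy.mon)" if "k \<ge> 1" for k
  proof -
    have "catalan_elt q k - scale (lead_coef k) (xy_word k) + scale (lead_coef k) (xy_word k) \<in> xy.span_ge 0"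
      using xy.span_ge_mono[OF _ catalan_elt_span[OF that], of 0]
        xy.span_ge_mono[OF _ xy_word_span[OF that], of 0]
      by (intro pm.span_add pm.span_scale) simp_all
    then show ?thesis by simp
  qed
  then show ?thesis using assms xy.span_mon_commute by blast
qed

sublocale cat: commuting_family q "\<lambda>i. catalan_elt q (Suc i)"
  by unfold_locales (simp_all add: q0 catalan_elt_commute)

lemma cat_mon_leading_term:
  "cat.mon M - scale (\<Prod>i\<in>#M. lead_coef (Suc i)) (xy.mon M) \<in> xy.span_ge (Suc (size M))"
proof (induction M)
  case empty
  show ?case by (simp add: pm.span_zero)
next
  case (add i M)
  define \<gamma> where "\<gamma> = (\<Prod>i\<in>#M. lead_coef (Suc i))"
  define r where "r = catalan_elt q (Suc i) - scale (lead_coef (Suc i)) (xy_word (Suc i))"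
  define R where "R = cat.mon M - scale \<gamma> (xy.mon M)"
  have r: "r \<in> xy.span_ge 2" unfolding r_def by (rule catalan_elt_span) simp
  have R: "R \<in> xy.span_ge (Suc (size M))" unfolding R_def \<gamma>_def by (rule add.IH)
  have C: "cat.mon M = scale \<gamma> (xy.mon M) + R" by (simp add: R_def)
  have "catalan_elt q (Suc i) = scale (lead_coef (Suc i)) (xy_word (Suc i)) + r" by (simp add: r_def)
  then have "cat.mon (add_mset i M) - scale (lead_coef (Suc i) * \<gamma>) (xy.mon (add_mset i M)) =
      scale (lead_coef (Suc i)) (qshuffle q (xy_word (Suc i)) R) + qshuffle q r (cat.mon M)"
    by (simp add: cat.mon_add_mset xy.mon_add_mset qshuffle_linear C pm.scale_right_distrib)
  moreover have "qshuffle q (xy_word (Suc i)) R \<in> xy.span_ge (Suc (Suc (size M)))"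
    using xy.qshuffle_span_ge[OF xy_word_span R, of "Suc i"] by simp
  moreover have "cat.mon M \<in> xy.span_ge (size M)"
    unfolding C using xy.span_ge_mono[OF _ R, of "size M"] xy.mon_span_ge[of "size M" M]
    by (intro pm.span_add pm.span_scale) simp_all
  then have "qshuffle q r (cat.mon M) \<in> xy.span_ge (Suc (Suc (size M)))"
    using xy.qshuffle_span_ge[OF r] by simp
  ultimately show ?case by (simp add: \<gamma>_def pm.span_add pm.span_scale)
qed

lemma independent_family_cat_mon: "independent_family cat.mon"
  by (rule independent_family_leading_term[OF independent_family_xy_mon cat_mon_leading_term])
    (auto simp: prod_mset_zero_iff lead_coef_nonzero)

end

section \<open>The isomorphism\<close>

text \<open>
  The monomials of the polynomial algebra are exponent functions, those of a commuting family are
  indexed by multisets; \<open>exponents\<close> is the bijection between the two.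
\<close>
definition exponents :: "(nat \<Rightarrow>\<^sub>0 nat) \<Rightarrow> nat multiset" where
  "exponents m = (\<Sum>i\<in>keys m. replicate_mset (lookup m i) i)"

lemma count_exponents: "count (exponents m) i = lookup m i"
proof -
  have "count (exponents m) i = (\<Sum>j\<in>keys m. if j = i then lookup m i else 0)"
    unfolding exponents_def count_sum by (intro sum.cong) auto
  then show ?thesis by (auto simp: sum.delta in_keys_iff)
qed

lemma exponents_add: "exponents (m + m') = exponents m + exponents m'"
  by (rule multiset_eqI) (simp add: count_exponents lookup_add)

lemma exponents_zero: "exponents 0 = {#}"
  by (rule multiset_eqI) (simp add: count_exponents)

lemma exponents_single: "exponents (Poly_Mapping.single i 1) = {#i#}"
  by (rule multiset_eqI) (auto simp: count_exponents lookup_single)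

lemma inj_exponents: "inj exponents"
  by (rule injI, rule poly_mapping_eqI) (metis count_exponents)

text \<open>
  Evaluation at any commuting family is a homomorphism onto the generated subalgebra; independence of
  the monomials is exactly its injectivity.
\<close>
lemma (in commuting_family) polys_iso_onto_hull:
  fixes \<phi> :: "'a polys \<Rightarrow> 'a vv"
  assumes indep: "independent_family mon"
  defines "\<phi> \<equiv> extend (\<lambda>m. mon (exponents m))"
  shows "polys_iso_onto q \<phi> (qshuffle_subalgebra q hull range g)"
    and "\<phi> (Poly_Mapping.single (Poly_Mapping.single i 1) 1) = g i"
proof -
  have gen: "\<phi> (Poly_Mapping.single (Poly_Mapping.single i 1) 1) = g i" for i
    unfolding \<phi>_def extend_single exponents_single by (simp add: mon_add_mset qshuffle_one)
  then show "\<phi> (Poly_Mapping.single (Poly_Mapping.single i 1) 1) = g i" .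
  have one: "\<phi> 1 = word_elt []"
    using extend_single[of "\<lambda>m. mon (exponents m)" 0 1] by (simp add: \<phi>_def exponents_zero)
  have add: "\<phi> (f + f') = \<phi> f + \<phi> f'" for f f'
    by (simp add: \<phi>_def extend_add)
  have scale: "\<phi> (scale c f) = scale c (\<phi> f)" for c f
    by (simp add: \<phi>_def extend_scale)
  have mult: "\<phi> (f * f') = qshuffle q (\<phi> f) (\<phi> f')" for f f'
  proof -
    have "f * f' = (\<Sum>m\<in>keys f. \<Sum>m'\<in>keys f'.
        Poly_Mapping.single (m + m') (lookup f m * lookup f' m'))"
      by (subst poly_mapping_eq_sum_single[of f], subst poly_mapping_eq_sum_single[of f'])
        (simp add: sum_product mult_single)
    then have "\<phi> (f * f') = (\<Sum>m\<in>keys f. \<Sum>m'\<in>keys f'. scale (lookup f m * lookup f' m')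
        (qshuffle q (mon (exponents m)) (mon (exponents m'))))"
      by (simp add: \<phi>_def extend_sum extend_single exponents_add mon_union)
    also have "\<dots> = qshuffle q (\<phi> f) (\<phi> f')"
      unfolding \<phi>_def extend_def[of _ f] extend_def[of _ f'] qshuffle_sum(1)
      unfolding qshuffle_sum(2) by (simp add: qshuffle_linear mult.commute)
    finally show ?thesis .
  qed
  have inj: "inj \<phi>"
    unfolding \<phi>_def by (rule inj_extend[OF independent_family_comp[OF indep inj_exponents]])
  have "range \<phi> = qshuffle_subalgebra q hull range g"
  proof
    show "qshuffle_subalgebra q hull range g \<subseteq> range \<phi>"
    proof (rule hull_minimal)
      show "range g \<subseteq> range \<phi>" using gen by (metis image_subsetI rangeI)
      show "qshuffle_subalgebra q (range \<phi>)"
        unfolding qshuffle_subalgebra_def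
        by (auto simp flip: one add scale mult)
    qed
  next
    show "range \<phi> \<subseteq> qshuffle_subalgebra q hull range g"
      unfolding hull_def
    proof (intro Inter_greatest, clarify)
      fix S p
      assume S: "qshuffle_subalgebra q S" "range g \<subseteq> S"
      have mon: "mon M \<in> S" for M
      proof (induction M)
        case (add i M)
        have "g i \<in> S" using S(2) by auto
        then show ?case using S(1) add.IH by (simp add: qshuffle_subalgebra_def mon_add_mset)
      qed (use S in \<open>simp add: qshuffle_subalgebra_def\<close>)
      have "word_elt [] \<in> S" using S by (simp add: qshuffle_subalgebra_def)
      then have "scale 0 (word_elt []) \<in> S" using S(1) unfolding qshuffle_subalgebra_def by blast
      then have zero: "0 \<in> S" by simp
      have "(\<Sum>m\<in>I. scale (c m) (mon (s m))) \<in> S" for I :: "(nat \<Rightarrow>\<^sub>0 nat) set" and c s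
        using S(1) mon zero
        by (induction I rule: infinite_finite_induct) (auto simp: qshuffle_subalgebra_def)
      then show "\<phi> p \<in> S" by (simp add: \<phi>_def extend_def)
    qed
  qed
  with inj show "polys_iso_onto q \<phi> (qshuffle_subalgebra q hull range g)"
    by (simp add: polys_iso_onto_def add scale one mult bij_betw_def)
qed

theorem corollary1p9:
  fixes q :: "'a::field"
  assumes "q \<noteq> 0"
    and "\<And>n::nat. n \<ge> 1 \<Longrightarrow> q ^ n \<noteq> 1"
  shows "\<exists>\<phi>. polys_iso_onto q \<phi> (catalan_subalgebra q) \<and>
           (\<forall>n\<ge>1. \<phi> (indet n) = catalan_elt q n)"
proof -
  interpret non_root_of_unity q using assms by unfold_locales
  have gens: "range (\<lambda>i. catalan_elt q (Suc i)) = catalan_elt q ` {1..}"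
  proof -
    have "{1..} = range Suc" by (auto simp: image_iff Suc_le_eq gr0_conv_Suc)
    then show ?thesis by (simp add: image_image)
  qed
  note iso = cat.polys_iso_onto_hull[OF independent_family_cat_mon]
  show ?thesis
  proof (intro exI conjI allI impI)
    show "polys_iso_onto q (extend (\<lambda>m. cat.mon (exponents m))) (catalan_subalgebra q)"
      using iso(1) by (simp add: catalan_subalgebra_def gens)
    show "extend (\<lambda>m. cat.mon (exponents m)) (indet n) = catalan_elt q n" if "n \<ge> 1" for n
      using iso(2)[of "n - 1"] that by (simp add: indet_def)
  qed
qed

end
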